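(* Let $b\in(0,1/2)$ and suppose $a=1-b$ or $a=1/2$. Then $$\mathbf{B}'_{a,b}+\mathbf{B}'_{a,b}\;\stackrel{d}{=}\;\mathbf{B}'_{2a,b}\times\left(1+\sqrt{\frac{\mathbf{B}_{a,1/2}}{\mathbf{B}_{b,1/2-b}}}\right),$$ where all random variables appearing on the same side of the identity are independent.
   Context: For $p,q>0$, $\mathbf{B}_{p,q}$ denotes a beta random variable with density $\frac{\Gamma(p+q)}{\Gamma(p)\Gamma(q)}x^{p-1}(1-x)^{q-1}$ on $(0,1)$, and $\mathbf{B}'_{p,q}$ denotes a beta prime random variable with density $\frac{\Gamma(p+q)}{\Gamma(p)\Gamma(q)}\frac{x^{p-1}}{(1+x)^{p+q}}$ on $(0,\infty)$. $X\stackrel{d}{=}Y$ means equality in distribution. *)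

theory Defs
  imports "HOL-Probability.Probability"
begin

definition beta_density :: "real \<Rightarrow> real \<Rightarrow> real \<Rightarrow> real" where
  "beta_density p q x =
     (if 0 < x \<and> x < 1
      then Gamma (p + q) / (Gamma p * Gamma q) * x powr (p - 1) * (1 - x) powr (q - 1)
      else 0)"

definition betaprime_density :: "real \<Rightarrow> real \<Rightarrow> real \<Rightarrow> real" where
  "betaprime_density p q x =
     (if 0 < x
      then Gamma (p + q) / (Gamma p * Gamma q) * x powr (p - 1) / (1 + x) powr (p + q)
      else 0)"

end

theory Submission
  imports Defs
begin

text \<open>Both sides have a density at \<open>s > 0\<close> of the form \<open>s powr (2a - 1)\<close> times a double integral, and only
  proportionality has to be shown, since both densities have mass one.

  On the left, substitute \<open>y = s e\<^sup>A / (1 + e\<^sup>A)\<close> in the convolution and linearise the product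
  \<open>((1 + y)(1 + s - y)) powr (-(a + b))\<close> by Feynman's formula with a further variable \<open>D\<close>. In the
  coordinates \<open>t = (A + D)/2\<close>, \<open>x = (D - A)/2\<close> the double integral becomes that of
  \<open>cosh((t - x)/2) powr (2b) ((1 + s) cosh t + cosh x) powr (-2(a + b))\<close> over the plane.

  On the right, put \<open>U = 1 / cosh\<^sup>2 t\<close> and \<open>V = 1 / cosh\<^sup>2 r\<close>; the double integral becomes that of
  \<open>(sinh r) powr (-2b) (cosh t + cosh r) powr b ((1 + s) cosh t + cosh r) powr (-(2a + b))\<close>
  over \<open>t, r > 0\<close>.

  The last factor is a fractional integral of \<open>((1 + s) cosh t + cosh x) powr (-2(a + b))\<close> over \<open>x > r\<close>.
  Exchanging the integrals leaves an integral over \<open>r\<close> in \<open>(0, x)\<close> which the binomial series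
  evaluates as a constant times \<open>cosh((t + x)/2) powr (2b) + cosh((t - x)/2) powr (2b)\<close>, and this is
  the left-hand integrand symmetrised in \<open>t\<close> and \<open>x\<close>.\<close>

section \<open>Change of variables for nonnegative integrals\<close>

lemma borel_measurable_sinh [measurable (raw)]:
  fixes f :: "'a \<Rightarrow> real"
  shows "f \<in> borel_measurable M \<Longrightarrow> (\<lambda>x. sinh (f x)) \<in> borel_measurable M"
  by (rule measurable_compose[OF _ borel_measurable_continuous_onI]) (auto intro!: continuous_intros)

lemma borel_measurable_cosh [measurable (raw)]:
  fixes f :: "'a \<Rightarrow> real"
  shows "f \<in> borel_measurable M \<Longrightarrow> (\<lambda>x. cosh (f x)) \<in> borel_measurable M"
  by (rule measurable_compose[OF _ borel_measurable_continuous_onI]) (auto intro!: continuous_intros)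

lemma borel_measurable_tanh [measurable (raw)]:
  fixes f :: "'a \<Rightarrow> real"
  assumes [measurable]: "f \<in> borel_measurable M"
  shows "(\<lambda>x. tanh (f x)) \<in> borel_measurable M"
  unfolding tanh_def by measurable

text \<open>Both sides integrate \<open>f\<close> against Borel measures: Lebesgue measure on
  \<open>T\<close>, and the image under \<open>g\<close> of the measure on \<open>S\<close> whose
  density is the absolute value of \<open>g'\<close>. Once these measures coincide, \<open>f\<close>
  may be infinite or non-integrable. On bounded sets they agree by the theorem for absolutely
  integrable functions; exhaustion extends this to all Borel sets.\<close>

lemma nn_integral_change_of_variables:
  fixes f :: "real \<Rightarrow> ennreal" and g :: "real \<Rightarrow> real"
  assumes S: "open S" and T: "T \<in> sets borel" and image: "g ` S = T" and inj: "inj_on g S"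
    and deriv: "\<And>x. x \<in> S \<Longrightarrow> (g has_real_derivative g' x) (at x)"
    and cont: "continuous_on S g'"
    and f[measurable]: "f \<in> borel_measurable borel"
  shows "(\<integral>\<^sup>+y\<in>T. f y \<partial>lborel) = (\<integral>\<^sup>+x\<in>S. f (g x) * ennreal \<bar>g' x\<bar> \<partial>lborel)"
proof -
  \<comment> \<open>Extension by 0 outside \<open>S\<close> makes both maps Borel on the whole line;
    the value 0 of \<open>h\<close> there is harmless because \<open>w\<close> gives no mass to the
    complement of \<open>S\<close>.\<close>
  define h where "h x = (if x \<in> S then g x else 0)" for x
  define w where "w x = ennreal (if x \<in> S then \<bar>g' x\<bar> else 0)" for x
  define \<mu> where "\<mu> = density lborel (indicator T :: real \<Rightarrow> ennreal)"
  define \<nu> where "\<nu> = distr (density lborel w) borel h"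
  have S_borel[measurable]: "S \<in> sets borel" and T_borel[measurable]: "T \<in> sets borel"
    using S T by auto
  have "continuous_on S g"
    using deriv by (meson DERIV_continuous_on has_field_derivative_at_within)
  hence h[measurable]: "h \<in> borel_measurable borel"
    unfolding h_def by (intro borel_measurable_continuous_on_if) auto
  have w[measurable]: "w \<in> borel_measurable borel"
    unfolding w_def using cont
    by (intro measurable_compose[OF borel_measurable_continuous_on_if measurable_ennreal])
      (auto intro!: continuous_intros)
  have emeasure_\<mu>: "emeasure \<mu> A = (\<integral>\<^sup>+y. ennreal (indicator A y) * indicator T y \<partial>lborel)"
    if A[measurable]: "A \<in> sets borel" for A
    unfolding \<mu>_def
    by (subst emeasure_density) (auto intro!: nn_integral_cong split: split_indicator simp del: nn_integral_indicator)
  have emeasure_\<nu>: "emeasure \<nu> A = (\<integral>\<^sup>+x. ennreal (\<bar>g' x\<bar> * indicator A (g x)) * indicator S x \<partial>lborel)"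
    if A[measurable]: "A \<in> sets borel" for A
  proof -
    have "h -` A \<in> sets borel"
      using measurable_sets[OF h A] by simp
    thus ?thesis
      unfolding \<nu>_def
      by (subst emeasure_distr, simp_all, subst emeasure_density)
        (auto intro!: nn_integral_cong split: split_indicator simp: w_def h_def)
  qed
  \<comment> \<open>For bounded \<open>A\<close> the set \<open>A \<inter> T\<close> has finite
    measure, so the indicator of \<open>A\<close> is absolutely integrable on \<open>T\<close> and
    both measures of \<open>A\<close> equal its integral \<open>I\<close>.\<close>
  have bounded_case: "emeasure \<mu> A = emeasure \<nu> A" if A[measurable]: "A \<in> sets borel" and "bounded A" for A
  proof -
    have lm: "A \<inter> T \<in> lmeasurable"
      using that(2) by (intro bounded_set_imp_lmeasurable) (auto intro: bounded_subset)
    have ai: "(indicator A :: real \<Rightarrow> real) absolutely_integrable_on g ` S"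
      using lm by (subst absolutely_integrable_on_iff_nonneg) (auto simp: integrable_on_indicator image)
    define I where "I = integral (g ` S) (indicator A :: real \<Rightarrow> real)"
    have ch: "(\<lambda>x. \<bar>g' x\<bar> * indicator A (g x)) absolutely_integrable_on S \<and>
              integral S (\<lambda>x. \<bar>g' x\<bar> * indicator A (g x)) = I"
      by (subst has_absolute_integral_change_of_variables_1')
        (use ai inj deriv in \<open>auto simp: I_def intro: has_field_derivative_at_within\<close>)
    hence 1: "((\<lambda>x. \<bar>g' x\<bar> * indicator A (g x)) has_integral I) S"
      by (metis has_integral_integrable_integral set_lebesgue_integral_eq_integral(1))
    have 2: "((indicator A :: real \<Rightarrow> real) has_integral I) T"
      using ai image unfolding I_def
      by (metis integrable_integral set_lebesgue_integral_eq_integral(1))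
    have "emeasure \<nu> A = ennreal I"
      unfolding emeasure_\<nu>[OF A] by (rule nn_integral_has_integral_lebesgue'[OF _ 1]) auto
    moreover have "emeasure \<mu> A = ennreal I"
      unfolding emeasure_\<mu>[OF A] by (rule nn_integral_has_integral_lebesgue'[OF _ 2]) auto
    ultimately show ?thesis by simp
  qed
  have "\<mu> = \<nu>"
  proof (rule measure_eqI)
    show "sets \<mu> = sets \<nu>" by (simp add: \<mu>_def \<nu>_def)
    fix A assume "A \<in> sets \<mu>"
    hence A[measurable]: "A \<in> sets borel" by (simp add: \<mu>_def)
    \<comment> \<open>Bounded exhaustion of \<open>A\<close>: both measures are continuous from
      below, so the bounded case suffices.\<close>
    define B where "B n = A \<inter> {- real n..real n}" for n
    have UN: "(\<Union>n. B n) = A"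
    proof -
      have "\<exists>n. - real n \<le> x \<and> x \<le> real n" for x
        by (metis abs_le_D1 abs_le_D2 minus_le_iff real_arch_simple)
      thus ?thesis by (auto simp: B_def)
    qed
    have inc: "incseq B" by (auto simp: B_def incseq_def)
    have "emeasure \<mu> A = (SUP n. emeasure \<mu> (B n))"
      by (subst SUP_emeasure_incseq) (use inc UN in \<open>auto simp: B_def \<mu>_def\<close>)
    also have "\<dots> = (SUP n. emeasure \<nu> (B n))"
      by (intro SUP_cong bounded_case) (auto simp: B_def intro: bounded_subset[of "{- real _..real _}"])
    also have "\<dots> = emeasure \<nu> A"
      by (subst SUP_emeasure_incseq) (use inc UN in \<open>auto simp: B_def \<nu>_def\<close>)
    finally show "emeasure \<mu> A = emeasure \<nu> A" .
  qed
  hence "(\<integral>\<^sup>+y. f y \<partial>\<mu>) = (\<integral>\<^sup>+y. f y \<partial>\<nu>)" by simp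
  also have "(\<integral>\<^sup>+y. f y \<partial>\<mu>) = (\<integral>\<^sup>+y\<in>T. f y \<partial>lborel)"
    unfolding \<mu>_def by (subst nn_integral_density) (auto simp: mult.commute)
  also have "(\<integral>\<^sup>+y. f y \<partial>\<nu>) = (\<integral>\<^sup>+x\<in>S. f (g x) * ennreal \<bar>g' x\<bar> \<partial>lborel)"
  proof -
    have "(\<lambda>x. f (h x)) \<in> borel_measurable borel" by measurable
    thus ?thesis
      unfolding \<nu>_def
      by (subst nn_integral_distr, simp_all, subst nn_integral_density)
        (auto intro!: nn_integral_cong split: split_indicator simp: w_def h_def mult.commute)
  qed
  finally show ?thesis .
qed

lemma nn_integral_Beta:
  fixes p q :: real
  assumes "p > 0" "q > 0"
  shows "(\<integral>\<^sup>+t\<in>{0<..<1}. ennreal (t powr (p - 1) * (1 - t) powr (q - 1)) \<partial>lborel) = ennreal (Beta p q)"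
  by (rule nn_integral_has_integral_lebesgue')
    (use has_integral_Beta_real[OF assms] in \<open>auto simp: has_integral_Icc_iff_Ioo\<close>)

lemma nn_integral_symmetrize:
  fixes f :: "real \<Rightarrow> ennreal"
  assumes [measurable]: "f \<in> borel_measurable borel"
  shows "(\<integral>\<^sup>+x. f x \<partial>lborel) = (\<integral>\<^sup>+x\<in>{0<..}. f x + f (- x) \<partial>lborel)"
proof -
  have "(\<integral>\<^sup>+x. f x \<partial>lborel) = (\<integral>\<^sup>+x. f x * indicator {0<..} x + f x * indicator {..<0} x \<partial>lborel)"
    by (intro nn_integral_cong_AE, rule AE_mp[OF AE_lborel_singleton[of 0]])
      (auto split: split_indicator intro!: AE_I2)
  also have "\<dots> = (\<integral>\<^sup>+x\<in>{0<..}. f x \<partial>lborel) + (\<integral>\<^sup>+x\<in>{..<0}. f x \<partial>lborel)"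
    by (rule nn_integral_add) auto
  also have "(\<integral>\<^sup>+x\<in>{..<0}. f x \<partial>lborel) = (\<integral>\<^sup>+x\<in>{0<..}. f (- x) \<partial>lborel)"
    by (subst nn_integral_real_affine[where c = "-1" and t = 0])
      (auto intro!: nn_integral_cong split: split_indicator)
  also have "(\<integral>\<^sup>+x\<in>{0<..}. f x \<partial>lborel) + (\<integral>\<^sup>+x\<in>{0<..}. f (- x) \<partial>lborel)
           = (\<integral>\<^sup>+x\<in>{0<..}. f x + f (- x) \<partial>lborel)"
    by (subst nn_integral_add[symmetric]) (auto intro!: nn_integral_cong simp: distrib_right)
  finally show ?thesis .
qed

section \<open>The kernel identity\<close>

lemma gchoose_Suc:
  fixes c :: "'a::field_char_0"
  shows "c gchoose (Suc n) = (c gchoose n) * (c - of_nat n) / of_nat (Suc n)"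
  by (metis gbinomial_absorb_comp gbinomial_absorption mult.commute nonzero_mult_div_cancel_left
      of_nat_neq_0)

text \<open>Passing from \<open>n\<close> to \<open>n + 1\<close> multiplies both sides by the same
  factor \<open>(n - b) (n + 1/2 - b) / ((n + 1) (n + 1/2))\<close>. This matches coefficients when
  a binomial series with exponent \<open>b\<close> is integrated against a beta kernel and an even
  series with exponent \<open>2 * b\<close> results.\<close>

lemma Beta_gchoose_even:
  fixes b :: real
  assumes "0 < b" "b < 1/2"
  shows "(b gchoose n) * (-1) ^ n * Beta (1/2 - b + real n) b
       = Beta (1/2 - b) b * (2 * b gchoose (2 * n))"
proof (induction n)
  case (Suc n)
  have "1/2 - b + real n \<notin> \<int>\<^sub>\<le>\<^sub>0"
    using assms by (auto elim!: nonpos_Ints_cases)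
  hence "(real n + 1/2) * Beta (1/2 - b + real n + 1) b = (1/2 - b + real n) * Beta (1/2 - b + real n) b"
    using Beta_plus1_left[of "1/2 - b + real n" b] by (simp add: add_ac)
  \<comment> \<open>The two arguments of Beta add up to \<open>real n + 1/2\<close>, which is the
    denominator in the recursion in the first argument.\<close>
  hence B: "Beta (1/2 - b + real (Suc n)) b
      = (1/2 - b + real n) / (real n + 1/2) * Beta (1/2 - b + real n) b"
    by (simp add: field_simps)
  have "(b gchoose Suc n) * (-1) ^ Suc n * Beta (1/2 - b + real (Suc n)) b
      = ((b gchoose n) * (-1) ^ n * Beta (1/2 - b + real n) b) *
        ((real n - b) / (real n + 1) * ((1/2 - b + real n) / (real n + 1/2)))"
    unfolding B gchoose_Suc by (simp add: field_simps)
  also have "\<dots> = Beta (1/2 - b) b * ((2 * b gchoose (2 * n)) *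
        ((real n - b) / (real n + 1) * ((1/2 - b + real n) / (real n + 1/2))))"
    by (subst Suc.IH) (simp only: mult.assoc)
  also have "(2 * b gchoose (2 * n)) * ((real n - b) / (real n + 1) * ((1/2 - b + real n) / (real n + 1/2)))
      = (2 * b gchoose (2 * Suc n))"
    by (simp add: gchoose_Suc divide_simps) (simp add: algebra_simps)
  finally show ?case .
qed simp

text \<open>Averaging the binomial series at \<open>t\<close> and \<open>- t\<close> cancels the odd
  powers; the surviving terms are reindexed by \<open>2 * n\<close>.\<close>

lemma even_binomial_series:
  fixes c t :: real
  assumes "\<bar>t\<bar> < 1"
  shows "(\<lambda>n. (c gchoose (2 * n)) * t ^ (2 * n)) sums (((1 + t) powr c + (1 - t) powr c) / 2)"
proof -
  have "(\<lambda>n. ((c gchoose n) * t ^ n + (c gchoose n) * (- t) ^ n) / 2)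
      sums (((1 + t) powr c + (1 - t) powr c) / 2)"
    using sums_add[OF gen_binomial_real[of t c] gen_binomial_real[of "- t" c]] assms
    by (intro sums_divide) auto
  hence "(\<lambda>n. if even n then (c gchoose n) * t ^ n else 0) sums (((1 + t) powr c + (1 - t) powr c) / 2)"
    by (rule sums_cong[THEN iffD1, rotated]) (auto simp: field_simps)
  thus ?thesis
    by (subst (asm) sums_mono_reindex[where g = "\<lambda>n. 2 * n", symmetric])
      (auto simp: strict_mono_def elim!: evenE)
qed

text \<open>In hypergeometric terms this is \<open>F(-b, 1/2 - b; 1/2; t\<^sup>2) = ((1 + t)\<^sup>2\<^sup>b + (1 - t)\<^sup>2\<^sup>b) / 2\<close>.\<close>

lemma nn_integral_Beta_binomial:
  fixes b t :: real
  assumes b: "0 < b" "b < 1/2" and t: "0 \<le> t" "t < 1"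
  shows "(\<integral>\<^sup>+w\<in>{0<..<1}. ennreal (w powr (1/2 - b - 1) * (1 - w) powr (b - 1) * (1 - t\<^sup>2 * w) powr b) \<partial>lborel)
       = ennreal (Beta (1/2 - b) b / 2 * ((1 + t) powr (2 * b) + (1 - t) powr (2 * b)))"
proof -
  \<comment> \<open>\<open>c n\<close> is the coefficient of \<open>(t\<^sup>2 * w) ^ n\<close> in
    the series of \<open>(1 - t\<^sup>2 * w) powr b\<close>, and \<open>\<phi> n\<close> absorbs
    \<open>w ^ n\<close> into the beta kernel, so that each term integrates to a Beta value.\<close>
  define c where "c n = (b gchoose n) * (-1) ^ n" for n
  define \<phi> where "\<phi> n w = indicator {0<..<1} w * (w powr (1/2 - b + real n - 1) * (1 - w) powr (b - 1))"
    for n and w :: real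
  define f where "f n w = c n * t ^ (2 * n) * \<phi> n w" for n w
  have t2: "t\<^sup>2 < 1" using t by (simp add: power_less_one_iff)
  have Beta_pos: "0 < Beta (1/2 - b + real n) b" for n
    using b by (simp add: Beta_def)
  have \<phi>_measurable: "\<phi> n \<in> borel_measurable borel" for n
    unfolding \<phi>_def[abs_def] by measurable
  have \<phi>: "has_bochner_integral lborel (\<phi> n) (Beta (1/2 - b + real n) b)" for n
  proof (rule has_bochner_integral_nn_integral)
    have "(\<integral>\<^sup>+w. ennreal (\<phi> n w) \<partial>lborel) =
      (\<integral>\<^sup>+w\<in>{0<..<1}. ennreal (w powr (1/2 - b + real n - 1) * (1 - w) powr (b - 1)) \<partial>lborel)"
      by (intro nn_integral_cong) (auto simp: \<phi>_def split: split_indicator)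
    also have "\<dots> = ennreal (Beta (1/2 - b + real n) b)"
      using b by (intro nn_integral_Beta) auto
    finally show "(\<integral>\<^sup>+w. ennreal (\<phi> n w) \<partial>lborel) = ennreal (Beta (1/2 - b + real n) b)" .
  qed (use Beta_pos[of n] \<phi>_measurable in \<open>auto simp: \<phi>_def split: split_indicator\<close>)
  have f_int: "has_bochner_integral lborel (f n) (c n * t ^ (2 * n) * Beta (1/2 - b + real n) b)" for n
    unfolding f_def by (intro has_bochner_integral_mult_right \<phi>)
  have abs_sum: "summable (\<lambda>n. \<bar>c n\<bar> * t ^ (2 * n))"
  proof -
    \<comment> \<open>The series converges at a radius strictly between \<open>t\<^sup>2\<close> and
      1, hence absolutely at \<open>t\<^sup>2\<close>.\<close>
    obtain r where r: "t\<^sup>2 < r" "r < 1" using dense[OF t2] by auto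
    have "0 \<le> r" using r(1) zero_le_power2[of t] by linarith
    have "summable (\<lambda>n. (b gchoose n) * (- r) ^ n)"
      using gen_binomial_real[of "- r" b] r \<open>0 \<le> r\<close> by (auto simp: sums_iff)
    hence "summable (\<lambda>n. norm ((b gchoose n) * (- t\<^sup>2) ^ n))"
      by (rule powser_insidea) (use r \<open>0 \<le> r\<close> in auto)
    moreover have "norm ((b gchoose n) * (- t\<^sup>2) ^ n) = \<bar>c n\<bar> * t ^ (2 * n)" for n
      by (simp add: c_def abs_mult power_mult power_abs)
    ultimately show ?thesis by simp
  qed
  have series: "(\<lambda>n. f n w) sums
      (indicator {0<..<1} w * (w powr (1/2 - b - 1) * (1 - w) powr (b - 1) * (1 - t\<^sup>2 * w) powr b))" for w
  proof (cases "w \<in> {0<..<1}")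
    case True
    have "t\<^sup>2 * w \<le> t\<^sup>2" using True by (intro mult_left_le) auto
    hence "\<bar>- (t\<^sup>2 * w)\<bar> < 1" using t2 True by (simp add: abs_mult)
    hence sums: "(\<lambda>n. (b gchoose n) * (- (t\<^sup>2 * w)) ^ n) sums (1 - t\<^sup>2 * w) powr b"
      using gen_binomial_real[of "- (t\<^sup>2 * w)" b] by simp
    have "f n w = w powr (1/2 - b - 1) * (1 - w) powr (b - 1) * ((b gchoose n) * (- (t\<^sup>2 * w)) ^ n)" for n
    proof -
      have "w powr (1/2 - b + real n - 1) = w powr (1/2 - b - 1 + real n)" by (simp add: algebra_simps)
      also have "\<dots> = w powr (1/2 - b - 1) * w ^ n"
        using True by (subst powr_add) (simp add: powr_realpow)
      finally show ?thesis
        using True by (simp add: f_def \<phi>_def c_def power_mult power_mult_distrib power_minus[of "_ * _"])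
    qed
    thus ?thesis
      using sums_mult[OF sums, of "w powr (1/2 - b - 1) * (1 - w) powr (b - 1)"] True by simp
  qed (simp add: f_def \<phi>_def)
  \<comment> \<open>On the unit interval \<open>w ^ n\<close> is at most 1, so
    \<open>\<phi> n\<close> is bounded by \<open>\<phi> 0\<close> and the series in
    \<open>abs_sum\<close> dominates.\<close>
  have norm_sum: "summable (\<lambda>n. norm (f n w))" for w
  proof (rule summable_comparison_test')
    show "summable (\<lambda>n. \<bar>c n\<bar> * t ^ (2 * n) * \<phi> 0 w)"
      by (intro summable_mult2 abs_sum)
    fix n :: nat
    show "norm (norm (f n w)) \<le> \<bar>c n\<bar> * t ^ (2 * n) * \<phi> 0 w"
      using b t unfolding f_def
      by (auto simp: abs_mult \<phi>_def power_abs split: split_indicator intro!: mult_left_mono mult_right_mono powr_mono')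
  qed
  \<comment> \<open>The integrated norms are summable because Beta is decreasing in its first
    argument; together with \<open>norm_sum\<close> this licenses termwise integration.\<close>
  have int_norm_sum: "summable (\<lambda>n. (LINT w|lborel. norm (f n w)))"
  proof (rule summable_comparison_test')
    show "summable (\<lambda>n. \<bar>c n\<bar> * t ^ (2 * n) * Beta (1/2 - b) b)"
      by (intro summable_mult2 abs_sum)
    fix n :: nat
    have "norm (f n w) = \<bar>c n\<bar> * t ^ (2 * n) * \<phi> n w" for w
      using t by (auto simp: f_def abs_mult \<phi>_def power_abs split: split_indicator)
    hence "(LINT w|lborel. norm (f n w)) = \<bar>c n\<bar> * t ^ (2 * n) * Beta (1/2 - b + real n) b"
      using has_bochner_integral_mult_right[OF \<phi>, of "\<bar>c n\<bar> * t ^ (2 * n)" n]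
      by (simp add: has_bochner_integral_iff)
    moreover have "Beta (1/2 - b + real n) b \<le> Beta (1/2 - b) b"
      using b by (intro Beta_real_mono) auto
    ultimately show "norm (LINT w|lborel. norm (f n w)) \<le> \<bar>c n\<bar> * t ^ (2 * n) * Beta (1/2 - b) b"
      using t Beta_pos[of n] by (auto simp: abs_mult intro!: mult_left_mono)
  qed
  define F where "F w = (\<Sum>n. f n w)" for w
  have F: "F w = indicator {0<..<1} w * (w powr (1/2 - b - 1) * (1 - w) powr (b - 1) * (1 - t\<^sup>2 * w) powr b)" for w
    using series[of w] by (simp add: F_def sums_iff)
  have f_integrable: "integrable lborel (f n)" for n
    using f_int[of n] by (simp add: has_bochner_integral_iff)
  have F_int: "integrable lborel F"
    unfolding F_def by (rule integrable_suminf) (use f_integrable norm_sum int_norm_sum in auto)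
  have "(LINT w|lborel. F w) = (\<Sum>n. LINT w|lborel. f n w)"
    unfolding F_def by (rule integral_suminf) (use f_integrable norm_sum int_norm_sum in auto)
  also have "\<dots> = (\<Sum>n. Beta (1/2 - b) b * ((2 * b gchoose (2 * n)) * t ^ (2 * n)))"
  proof (rule suminf_cong)
    fix n
    have "(LINT w|lborel. f n w) = (c n * Beta (1/2 - b + real n) b) * t ^ (2 * n)"
      using f_int[of n] by (simp add: has_bochner_integral_iff)
    \<comment> \<open>The coefficient identity turns the integrated series into the even part of the
      binomial series with exponent \<open>2 * b\<close>.\<close>
    also have "c n * Beta (1/2 - b + real n) b = Beta (1/2 - b) b * (2 * b gchoose (2 * n))"
      unfolding c_def by (rule Beta_gchoose_even[OF b])
    finally show "(LINT w|lborel. f n w) = Beta (1/2 - b) b * ((2 * b gchoose (2 * n)) * t ^ (2 * n))"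
      by simp
  qed
  also have "\<dots> = Beta (1/2 - b) b * (((1 + t) powr (2 * b) + (1 - t) powr (2 * b)) / 2)"
    using even_binomial_series[of t "2 * b"] t by (intro sums_unique[symmetric] sums_mult) auto
  finally have "(LINT w|lborel. F w) = Beta (1/2 - b) b / 2 * ((1 + t) powr (2 * b) + (1 - t) powr (2 * b))"
    by simp
  moreover have "(\<integral>\<^sup>+w. ennreal (F w) \<partial>lborel) = ennreal (LINT w|lborel. F w)"
    by (rule nn_integral_eq_integral[OF F_int]) (auto simp: F split: split_indicator)
  moreover have "(\<integral>\<^sup>+w. ennreal (F w) \<partial>lborel) = (\<integral>\<^sup>+w\<in>{0<..<1}. ennreal (w powr (1/2 - b - 1) * (1 - w) powr (b - 1) * (1 - t\<^sup>2 * w) powr b) \<partial>lborel)"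
    by (intro nn_integral_cong) (auto simp: F split: split_indicator)
  ultimately show ?thesis by (simp only:)
qed

text \<open>The substitution is \<open>y = (cosh x - cosh r) / (m + cosh x)\<close>.\<close>

lemma nn_integral_cosh_shift:
  fixes b c m r :: real
  assumes "b > 0" "c > 0" "m \<ge> 0" "r > 0"
  shows "(\<integral>\<^sup>+x\<in>{r<..}. ennreal (sinh x * (cosh x - cosh r) powr (b - 1) * (m + cosh x) powr (- (b + c))) \<partial>lborel)
       = ennreal (Beta b c * (m + cosh r) powr (- c))"
proof -
  define g where "g x = (cosh x - cosh r) / (m + cosh x)" for x
  define g' where "g' x = (m + cosh r) * sinh x / (m + cosh x)\<^sup>2" for x
  have pos: "m + cosh x > 0" for x
    using assms cosh_real_pos[of x] by linarith
  \<comment> \<open>The complement of \<open>g\<close> depends on \<open>x\<close> only through its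
    denominator; this yields injectivity and the second factor of the beta integrand.\<close>
  have g_compl: "1 - g x = (m + cosh r) / (m + cosh x)" for x
    using pos[of x] by (simp add: g_def field_simps)
  have less: "cosh r < cosh x" if "x > r" for x
    using that assms by (simp add: cosh_real_nonneg_less_iff)
  have inj: "inj_on g {r<..}"
  proof (rule inj_onI)
    fix x y assume xy: "x \<in> {r<..}" "y \<in> {r<..}" "g x = g y"
    hence "(m + cosh r) / (m + cosh x) = (m + cosh r) / (m + cosh y)"
      by (metis g_compl)
    hence "cosh x = cosh y"
      using pos[of x] pos[of y] pos[of r] by (simp add: field_simps)
    thus "x = y"
      using xy assms cosh_real_nonneg_less_iff[of x y] cosh_real_nonneg_less_iff[of y x] by auto
  qed
  have image: "g ` {r<..} = {0<..<1}"
  proof (intro equalityI subsetI)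
    fix y assume "y \<in> g ` {r<..}"
    then obtain x where "x > r" "y = g x" by auto
    moreover have "0 < 1 - g x" unfolding g_compl using pos by simp
    ultimately show "y \<in> {0<..<1}" using pos[of x] less[of x] by (simp add: g_def)
  next
    fix y :: real assume y: "y \<in> {0<..<1}"
    \<comment> \<open>\<open>z\<close> is the value of \<open>cosh x\<close> that solves
      \<open>g x = y\<close>.\<close>
    define z where "z = (cosh r + m * y) / (1 - y)"
    have "z - cosh r = (cosh r + m) * y / (1 - y)"
      using y by (simp add: z_def field_simps)
    also have "\<dots> > 0" using y pos[of r] by (intro divide_pos_pos mult_pos_pos) (auto simp: add_ac)
    finally have zr: "z > cosh r" by simp
    hence z: "cosh (arcosh z) = z" "arcosh z \<ge> 0"
      using cosh_real_ge_1[of r] by (auto intro!: cosh_arcosh_real)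
    hence "arcosh z > r"
      using zr assms cosh_real_nonneg_less_iff[of r "arcosh z"] by simp
    moreover have "g (arcosh z) = y"
    proof -
      have "(1 - y) * z = cosh r + m * y" using y by (simp add: z_def)
      hence "z - cosh r = y * (m + z)" by (simp add: algebra_simps)
      thus ?thesis using pos[of "arcosh z"] by (simp add: g_def z)
    qed
    ultimately show "y \<in> g ` {r<..}" by force
  qed
  have deriv: "(g has_real_derivative g' x) (at x)" for x
    unfolding g_def g'_def
    by (rule derivative_eq_intros refl | use pos[of x] in \<open>simp add: power2_eq_square algebra_simps\<close>)+
  have "ennreal (Beta b c) = (\<integral>\<^sup>+t\<in>{0<..<1}. ennreal (t powr (b - 1) * (1 - t) powr (c - 1)) \<partial>lborel)"
    using assms by (simp add: nn_integral_Beta)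
  also have "\<dots> = (\<integral>\<^sup>+x\<in>{r<..}. ennreal (g x powr (b - 1) * (1 - g x) powr (c - 1)) * ennreal \<bar>g' x\<bar> \<partial>lborel)"
    by (rule nn_integral_change_of_variables[OF _ _ image inj deriv])
      (use pos in \<open>auto simp: g'_def power2_eq_square less_imp_neq[symmetric] intro!: continuous_intros\<close>)
  also have "\<dots> = (\<integral>\<^sup>+x. ennreal ((m + cosh r) powr c) *
      (ennreal (sinh x * (cosh x - cosh r) powr (b - 1) * (m + cosh x) powr (- (b + c))) * indicator {r<..} x) \<partial>lborel)"
  proof (intro nn_integral_cong)
    fix x :: real
    have "g x powr (b - 1) * (1 - g x) powr (c - 1) * \<bar>g' x\<bar> =
        (m + cosh r) powr c * (sinh x * (cosh x - cosh r) powr (b - 1) * (m + cosh x) powr (- (b + c)))"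
      if "x > r"
    proof -
      \<comment> \<open>The positive bases are written as exponentials, so that an identity between
        real powers reduces to arithmetic on the exponents.\<close>
      have powr_eq: "(P / Q) powr (b - 1) * (H / Q) powr (c - 1) * (H * s / Q\<^sup>2)
          = H powr c * (s * P powr (b - 1) * Q powr (- (b + c)))"
        if pos: "P > 0" "Q > 0" "H > 0" for P Q H s :: real
      proof -
        obtain p q h where [simp]: "P = exp p" "Q = exp q" "H = exp h"
          using pos by (metis exp_ln)
        show ?thesis
          by (simp add: powr_def ln_mult ln_div divide_inverse power2_eq_square flip: exp_add exp_minus)
            (simp add: algebra_simps flip: exp_add)
      qed
      have "sinh x > 0" using that assms by simp
      hence "\<bar>g' x\<bar> = (m + cosh r) * sinh x / (m + cosh x)\<^sup>2"
        using pos[of x] pos[of r] by (simp add: g'_def)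
      thus ?thesis
        using powr_eq[of "cosh x - cosh r" "m + cosh x" "m + cosh r" "sinh x"] that less[of x] pos
        unfolding g_compl by (simp only: g_def diff_gt_0_iff_gt)
    qed
    thus "ennreal (g x powr (b - 1) * (1 - g x) powr (c - 1)) * ennreal \<bar>g' x\<bar> * indicator {r<..} x =
      ennreal ((m + cosh r) powr c) *
      (ennreal (sinh x * (cosh x - cosh r) powr (b - 1) * (m + cosh x) powr (- (b + c))) * indicator {r<..} x)"
      by (auto split: split_indicator simp flip: ennreal_mult')
  qed
  also have "\<dots> = ennreal ((m + cosh r) powr c) * (\<integral>\<^sup>+x\<in>{r<..}.
      ennreal (sinh x * (cosh x - cosh r) powr (b - 1) * (m + cosh x) powr (- (b + c))) \<partial>lborel)"
    by (rule nn_integral_cmult) auto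
  finally have *: "ennreal (Beta b c) = ennreal ((m + cosh r) powr c) * (\<integral>\<^sup>+x\<in>{r<..}.
      ennreal (sinh x * (cosh x - cosh r) powr (b - 1) * (m + cosh x) powr (- (b + c))) \<partial>lborel)" .
  \<comment> \<open>The factor in front of the integral is finite and positive; multiplying by its
    opposite power isolates the integral.\<close>
  have "ennreal (Beta b c * (m + cosh r) powr (- c)) = ennreal ((m + cosh r) powr (- c)) * ennreal (Beta b c)"
    by (simp add: ennreal_mult'' mult.commute)
  also have "\<dots> = ennreal ((m + cosh r) powr (- c) * (m + cosh r) powr c) * (\<integral>\<^sup>+x\<in>{r<..}.
      ennreal (sinh x * (cosh x - cosh r) powr (b - 1) * (m + cosh x) powr (- (b + c))) \<partial>lborel)"
    unfolding * by (simp add: ennreal_mult' mult.assoc)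
  also have "(m + cosh r) powr (- c) * (m + cosh r) powr c = 1"
    using pos[of r] by (simp flip: powr_add)
  finally show ?thesis by simp
qed

text \<open>The substitution \<open>w = tanh\<^sup>2(r/2) / tanh\<^sup>2(x/2)\<close> reduces this to \<open>nn_integral_Beta_binomial\<close> with
  parameter \<open>tanh(t/2) tanh(x/2)\<close>.\<close>

lemma nn_integral_cosh_binomial:
  fixes b t x :: real
  assumes b: "0 < b" "b < 1/2" and t: "0 < t" and x: "0 < x"
  shows "(\<integral>\<^sup>+r\<in>{0<..<x}. ennreal (sinh r powr (- 2 * b) * (cosh t + cosh r) powr b *
            (cosh x - cosh r) powr (b - 1) * sinh x) \<partial>lborel)
       = ennreal (Beta (1/2 - b) b / 2 *
            (cosh ((t + x) / 2) powr (2 * b) + cosh ((t - x) / 2) powr (2 * b)))"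
proof -
  \<comment> \<open>\<open>q\<close> is the parameter passed to
    \<open>nn_integral_Beta_binomial\<close>. By the addition theorem \<open>k * (1 + q)\<close> is
    \<open>cosh ((t + x) / 2)\<close> and \<open>k * (1 - q)\<close> is
    \<open>cosh ((t - x) / 2)\<close>, so the factor \<open>k powr (2 * b)\<close> produces the two
    terms of the claim.\<close>
  define q where "q = tanh (t / 2) * tanh (x / 2)"
  define k where "k = cosh (t / 2) * cosh (x / 2)"
  define g where "g r = (tanh (r / 2) / tanh (x / 2))\<^sup>2" for r
  define g' where "g' r = tanh (r / 2) * (1 - (tanh (r / 2))\<^sup>2) / (tanh (x / 2))\<^sup>2" for r
  define f where "f w = w powr (1/2 - b - 1) * (1 - w) powr (b - 1) * (1 - q\<^sup>2 * w) powr b" for w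
  have tanh_x: "tanh (x / 2) > 0" using x by simp
  have q: "0 \<le> q" "q < 1"
    using t x tanh_real_lt_1[of "t / 2"] tanh_real_lt_1[of "x / 2"]
    mult_strict_mono[of "tanh (t / 2)" 1 "tanh (x / 2)" 1] by (auto simp: q_def)
  have k: "k > 0" by (simp add: k_def)
  have inj: "inj_on g {0<..<x}"
  proof (rule inj_onI)
    fix r y assume *: "r \<in> {0<..<x}" "y \<in> {0<..<x}" "g r = g y"
    hence "(tanh (r / 2))\<^sup>2 = (tanh (y / 2))\<^sup>2" using tanh_x by (simp add: g_def power_divide)
    hence "tanh (r / 2) = tanh (y / 2)" using * by (subst (asm) power2_eq_iff_nonneg) auto
    thus "r = y" by simp
  qed
  have image: "g ` {0<..<x} = {0<..<1}"
  proof (intro equalityI subsetI)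
    fix y assume "y \<in> g ` {0<..<x}"
    then obtain r where r: "0 < r" "r < x" "y = g r" by auto
    hence "0 < tanh (r / 2) / tanh (x / 2)" "tanh (r / 2) / tanh (x / 2) < 1"
      using tanh_x by auto
    thus "y \<in> {0<..<1}" using r by (simp add: g_def power_less_one_iff)
  next
    fix y :: real assume y: "y \<in> {0<..<1}"
    \<comment> \<open>Solving \<open>g r = y\<close> for positive \<open>r\<close> means
      \<open>tanh (r / 2) = z\<close>. The intermediate value theorem gives such an
      \<open>r\<close>, and monotonicity of tanh places it strictly between 0 and
      \<open>x\<close>.\<close>
    define z where "z = sqrt y * tanh (x / 2)"
    have "sqrt y < 1" using y by simp
    hence z: "0 < z" "z < tanh (x / 2)" using y tanh_x by (auto simp: z_def)
    have "continuous_on {0..x} (\<lambda>r. tanh (r / 2))"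
      by (intro continuous_intros) auto
    then obtain r where tr: "tanh (r / 2) = z"
      using IVT'[of "\<lambda>r. tanh (r / 2)" 0 z x] z x by auto
    have "0 < r" using z tr tanh_real_pos_iff[of "r / 2"] by simp
    moreover have "r < x" using z tr tanh_real_less_iff[of "r / 2" "x / 2"] by simp
    moreover have "g r = y" using y tanh_x by (simp add: g_def tr z_def)
    ultimately show "y \<in> g ` {0<..<x}" by force
  qed
  have deriv: "(g has_real_derivative g' r) (at r)" for r
    unfolding g_def g'_def
    by (rule derivative_eq_intros refl | use tanh_x in \<open>simp add: power2_eq_square\<close>)+
  have "ennreal (Beta (1/2 - b) b / 2 * ((1 + q) powr (2 * b) + (1 - q) powr (2 * b)))
      = (\<integral>\<^sup>+w\<in>{0<..<1}. ennreal (f w) \<partial>lborel)"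
    unfolding f_def by (rule nn_integral_Beta_binomial[OF b q, symmetric])
  also have "\<dots> = (\<integral>\<^sup>+r\<in>{0<..<x}. ennreal (f (g r)) * ennreal \<bar>g' r\<bar> \<partial>lborel)"
    by (rule nn_integral_change_of_variables[OF _ _ image inj deriv])
      (use tanh_x in \<open>auto simp: g'_def f_def intro!: continuous_intros\<close>)
  finally have "ennreal (k powr (2 * b)) * ennreal (Beta (1/2 - b) b / 2 * ((1 + q) powr (2 * b) + (1 - q) powr (2 * b)))
     = ennreal (k powr (2 * b)) * (\<integral>\<^sup>+r\<in>{0<..<x}. ennreal (f (g r)) * ennreal \<bar>g' r\<bar> \<partial>lborel)"
    by simp
  also have "\<dots> = (\<integral>\<^sup>+r. ennreal (k powr (2 * b)) * (ennreal (f (g r)) * ennreal \<bar>g' r\<bar> * indicator {0<..<x} r) \<partial>lborel)"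
    by (rule nn_integral_cmult[symmetric]) (auto simp: f_def g_def g'_def)
  also have "\<dots> = (\<integral>\<^sup>+r\<in>{0<..<x}. ennreal (sinh r powr (- 2 * b) * (cosh t + cosh r) powr b *
            (cosh x - cosh r) powr (b - 1) * sinh x) \<partial>lborel)"
  proof (rule nn_integral_cong)
    fix r :: real
    have "k powr (2 * b) * (f (g r) * \<bar>g' r\<bar>) = sinh r powr (- 2 * b) * (cosh t + cosh r) powr b *
            (cosh x - cosh r) powr (b - 1) * sinh x" if r: "0 < r" "r < x"
    proof -
      \<comment> \<open>\<open>A\<close> and \<open>E\<close> stand for \<open>1 - g r\<close> and
        \<open>1 - q\<^sup>2 * g r\<close>. The variable \<open>n\<close> stands for the 2 of the
        double-angle formulas; its exponents \<open>- 2 * b\<close>, \<open>b\<close>,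
        \<open>b - 1\<close> and \<open>1\<close> sum to zero.\<close>
      have powr_eq: "(n * (S * C)) powr (- 2 * b) * (n * (w\<^sup>2 * C\<^sup>2 * E)) powr b * (n * (u\<^sup>2 * C\<^sup>2 * A)) powr (b - 1) * (n * (u * v))
       = (w * v) powr (2 * b) * (((S / C / (u / v))\<^sup>2) powr (1/2 - b - 1) * A powr (b - 1) * E powr b *
         (S / C * (1 / C\<^sup>2) / (u / v)\<^sup>2))"
        if pos: "n > 0" "S > 0" "C > 0" "u > 0" "v > 0" "w > 0" "A > 0" "E > 0"
        for n S C u v w A E :: real
      proof -
        obtain z s c u' v' w' a e where exps: "n = exp z" "S = exp s" "C = exp c" "u = exp u'"
            "v = exp v'" "w = exp w'" "A = exp a" "E = exp e"
          by (rule that[of "ln n" "ln S" "ln C" "ln u" "ln v" "ln w" "ln A" "ln E"]) (simp_all add: pos)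
        have exp_powr: "exp x powr y = exp (y * x)" for x y :: real by (simp add: powr_def)
        show ?thesis unfolding exps
          by (simp only: exp_powr power2_eq_square divide_inverse mult_1_left flip: exp_add exp_minus)
            (simp add: algebra_simps)
      qed
      define S C u v s w where "S = sinh (r / 2)" "C = cosh (r / 2)" "u = sinh (x / 2)" "v = cosh (x / 2)"
        "s = sinh (t / 2)" "w = cosh (t / 2)"
      note defs = this
      have pos: "S > 0" "C > 0" "u > 0" "v > 0" "w > 0" using r x by (auto simp: defs)
      have sq: "C\<^sup>2 = S\<^sup>2 + 1" "v\<^sup>2 = u\<^sup>2 + 1" "w\<^sup>2 = s\<^sup>2 + 1"
        by (simp_all add: defs cosh_square_eq)
      have g_r: "g r = (S / C / (u / v))\<^sup>2" by (simp add: g_def tanh_def defs)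
      have "g r \<in> {0<..<1}" using image r by auto
      hence A: "0 < 1 - g r" by simp
      have "q\<^sup>2 * g r < 1 * 1"
        using \<open>g r \<in> _\<close> q by (intro mult_strict_mono) (auto simp: power_less_one_iff)
      hence E: "0 < 1 - q\<^sup>2 * g r" by simp
      have "sinh r = 2 * (S * C)" "sinh x = 2 * (u * v)"
        using sinh_double[of "r / 2"] sinh_double[of "x / 2"] by (simp_all add: defs)
      moreover have "cosh r = 2 * S\<^sup>2 + 1" "cosh x = 2 * u\<^sup>2 + 1" "cosh t = 2 * s\<^sup>2 + 1"
        using cosh_double[of "r / 2"] cosh_double[of "x / 2"] cosh_double[of "t / 2"]
        by (simp_all add: defs cosh_square_eq)
      \<comment> \<open>This and the next identity factor \<open>cosh x - cosh r\<close> and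
        \<open>cosh t + cosh r\<close> through the bases \<open>1 - g r\<close> and
        \<open>1 - q\<^sup>2 * g r\<close> of the beta integrand.\<close>
      moreover have "u\<^sup>2 * C\<^sup>2 * (1 - g r) = u\<^sup>2 - S\<^sup>2"
      proof -
        have "u\<^sup>2 * C\<^sup>2 * (1 - g r) = u\<^sup>2 * C\<^sup>2 - S\<^sup>2 * v\<^sup>2"
          using pos by (simp add: g_r field_simps)
        also have "\<dots> = u\<^sup>2 - S\<^sup>2" by (simp add: sq algebra_simps)
        finally show ?thesis .
      qed
      moreover have "w\<^sup>2 * C\<^sup>2 * (1 - q\<^sup>2 * g r) = s\<^sup>2 + S\<^sup>2 + 1"
      proof -
        have q_eq: "q = s / w * (u / v)" by (simp add: q_def tanh_def defs)
        have "w\<^sup>2 * C\<^sup>2 * (1 - q\<^sup>2 * g r) = w\<^sup>2 * C\<^sup>2 - s\<^sup>2 * S\<^sup>2"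
          unfolding g_r q_eq using pos by (simp add: field_simps)
        also have "\<dots> = s\<^sup>2 + S\<^sup>2 + 1" by (simp add: sq algebra_simps)
        finally show ?thesis .
      qed
      ultimately have *: "sinh r = 2 * (S * C)" "sinh x = 2 * (u * v)"
         "cosh t + cosh r = 2 * (w\<^sup>2 * C\<^sup>2 * (1 - q\<^sup>2 * g r))" "cosh x - cosh r = 2 * (u\<^sup>2 * C\<^sup>2 * (1 - g r))"
        by linarith+
      have "1 - (tanh (r / 2))\<^sup>2 = 1 / C\<^sup>2"
      proof -
        have "1 - (tanh (r / 2))\<^sup>2 = (C\<^sup>2 - S\<^sup>2) / C\<^sup>2"
          using pos(2) by (simp add: tanh_def power_divide diff_divide_distrib flip: defs)
        thus ?thesis by (simp add: sq(1))
      qed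
      hence "g' r = S / C * (1 / C\<^sup>2) / (u / v)\<^sup>2"
        by (simp add: g'_def tanh_def flip: defs)
      hence "\<bar>g' r\<bar> = S / C * (1 / C\<^sup>2) / (u / v)\<^sup>2" using pos by simp
      moreover have "f (g r) = ((S / C / (u / v))\<^sup>2) powr (1/2 - b - 1) * (1 - g r) powr (b - 1) * (1 - q\<^sup>2 * g r) powr b"
        unfolding f_def g_r ..
      moreover have "k = w * v" by (simp add: k_def defs)
      ultimately show ?thesis
        unfolding * by (simp only: powr_eq[OF zero_less_numeral pos(1-5) A E])
    qed
    thus "ennreal (k powr (2 * b)) * (ennreal (f (g r)) * ennreal \<bar>g' r\<bar> * indicator {0<..<x} r) =
      ennreal (sinh r powr (- 2 * b) * (cosh t + cosh r) powr b *
            (cosh x - cosh r) powr (b - 1) * sinh x) * indicator {0<..<x} r"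
      by (auto split: split_indicator simp: f_def simp flip: ennreal_mult')
  qed
  finally have "(\<integral>\<^sup>+r\<in>{0<..<x}. ennreal (sinh r powr (- 2 * b) * (cosh t + cosh r) powr b *
            (cosh x - cosh r) powr (b - 1) * sinh x) \<partial>lborel)
      = ennreal (k powr (2 * b) * (Beta (1/2 - b) b / 2 * ((1 + q) powr (2 * b) + (1 - q) powr (2 * b))))"
    by (simp only: ennreal_mult'[OF powr_ge_zero])
  also have "k powr (2 * b) * (Beta (1/2 - b) b / 2 * ((1 + q) powr (2 * b) + (1 - q) powr (2 * b)))
      = Beta (1/2 - b) b / 2 * ((k * (1 + q)) powr (2 * b) + (k * (1 - q)) powr (2 * b))"
  proof -
    have "(k * (1 + q)) powr (2 * b) = k powr (2 * b) * (1 + q) powr (2 * b)"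
      "(k * (1 - q)) powr (2 * b) = k powr (2 * b) * (1 - q) powr (2 * b)"
      using k q by (simp_all add: powr_mult)
    thus ?thesis by (simp only:) (simp add: algebra_simps)
  qed
  also have "k * (1 + q) = cosh (t / 2 + x / 2)"
    unfolding cosh_add by (simp add: k_def q_def tanh_def field_simps)
  also have "k * (1 - q) = cosh (t / 2 - x / 2)"
    unfolding cosh_diff by (simp add: k_def q_def tanh_def field_simps)
  finally show ?thesis by (simp only: add_divide_distrib diff_divide_distrib)
qed

text \<open>Tonelli: the factor \<open>(m + cosh r) powr (- c)\<close> is written as an integral over \<open>x > r\<close>, after which
  the integral over \<open>r\<close> in \<open>(0, x)\<close> has a closed form.\<close>

lemma nn_integral_cosh_kernel:
  fixes b c m t :: real
  assumes b: "0 < b" "b < 1/2" and c: "0 < c" and m: "0 \<le> m" and t: "0 < t"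
  shows "ennreal (Beta b c) * (\<integral>\<^sup>+r\<in>{0<..}. ennreal (sinh r powr (- 2 * b) * (cosh t + cosh r) powr b *
            (m + cosh r) powr (- c)) \<partial>lborel)
       = ennreal (Beta (1/2 - b) b / 2) * (\<integral>\<^sup>+x\<in>{0<..}. ennreal ((cosh ((t + x) / 2) powr (2 * b) +
            cosh ((t - x) / 2) powr (2 * b)) * (m + cosh x) powr (- (b + c))) \<partial>lborel)"
proof -
  \<comment> \<open>\<open>\<phi>\<close> depends on \<open>r\<close> alone, \<open>\<mu>\<close> on
    \<open>x\<close> alone, and \<open>\<psi>\<close> couples them: \<open>\<psi>\<close> with
    \<open>\<mu>\<close> is the integrand of \<open>nn_integral_cosh_shift\<close>, while
    \<open>\<psi>\<close> with \<open>\<phi>\<close> is that of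
    \<open>nn_integral_cosh_binomial\<close>.\<close>
  define \<phi> where "\<phi> r = sinh r powr (- 2 * b) * (cosh t + cosh r) powr b" for r
  define \<psi> where "\<psi> x r = (cosh x - cosh r) powr (b - 1) * sinh x" for x r
  define \<mu> where "\<mu> x = (m + cosh x) powr (- (b + c))" for x
  have [measurable]: "\<phi> \<in> borel_measurable borel" "\<mu> \<in> borel_measurable borel"
    "(\<lambda>(x, r). \<psi> x r) \<in> borel_measurable (borel \<Otimes>\<^sub>M borel)"
    unfolding \<phi>_def[abs_def] \<mu>_def[abs_def] \<psi>_def by measurable
  have nonneg: "0 \<le> \<phi> r" "0 \<le> \<mu> r" "0 < r \<Longrightarrow> 0 \<le> \<psi> r y" for r y
    by (simp_all add: \<phi>_def \<mu>_def \<psi>_def)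
  have "ennreal (Beta b c) * (\<integral>\<^sup>+r\<in>{0<..}. ennreal (sinh r powr (- 2 * b) * (cosh t + cosh r) powr b *
            (m + cosh r) powr (- c)) \<partial>lborel)
      = (\<integral>\<^sup>+r. ennreal (Beta b c) * (ennreal (sinh r powr (- 2 * b) * (cosh t + cosh r) powr b *
            (m + cosh r) powr (- c)) * indicator {0<..} r) \<partial>lborel)"
    by (rule nn_integral_cmult[symmetric]) measurable
  also have "\<dots> = (\<integral>\<^sup>+r. (\<integral>\<^sup>+x. ennreal (\<phi> r * \<psi> x r * \<mu> x) * indicator {(x, r). 0 < r \<and> r < x} (x, r) \<partial>lborel) \<partial>lborel)"
  proof (rule nn_integral_cong)
    fix r :: real
    show "ennreal (Beta b c) * (ennreal (sinh r powr (- 2 * b) * (cosh t + cosh r) powr b *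
            (m + cosh r) powr (- c)) * indicator {0<..} r)
        = (\<integral>\<^sup>+x. ennreal (\<phi> r * \<psi> x r * \<mu> x) * indicator {(x, r). 0 < r \<and> r < x} (x, r) \<partial>lborel)"
    proof (cases "0 < r")
      case True
      have "(\<integral>\<^sup>+x. ennreal (\<phi> r * \<psi> x r * \<mu> x) * indicator {(x, r). 0 < r \<and> r < x} (x, r) \<partial>lborel)
          = (\<integral>\<^sup>+x. ennreal (\<phi> r) * (ennreal (sinh x * (cosh x - cosh r) powr (b - 1) * (m + cosh x) powr (- (b + c))) * indicator {r<..} x) \<partial>lborel)"
        using True nonneg(1)[of r]
        by (intro nn_integral_cong) (auto simp: \<psi>_def \<mu>_def mult_ac split: split_indicator simp flip: ennreal_mult')
      also have "\<dots> = ennreal (\<phi> r) * (\<integral>\<^sup>+x\<in>{r<..}. ennreal (sinh x * (cosh x - cosh r) powr (b - 1) * (m + cosh x) powr (- (b + c))) \<partial>lborel)"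
        by (rule nn_integral_cmult) measurable
      also have "\<dots> = ennreal (\<phi> r) * ennreal (Beta b c * (m + cosh r) powr (- c))"
        by (subst nn_integral_cosh_shift) (use b c m True in auto)
      also have "\<dots> = ennreal (Beta b c) * ennreal (\<phi> r * (m + cosh r) powr (- c))"
        using nonneg(1)[of r] by (simp add: ennreal_mult' ennreal_mult'' mult_ac)
      finally show ?thesis using True by (simp add: \<phi>_def)
    qed simp
  qed
  also have "\<dots> = (\<integral>\<^sup>+x. (\<integral>\<^sup>+r. ennreal (\<phi> r * \<psi> x r * \<mu> x) * indicator {(x, r). 0 < r \<and> r < x} (x, r) \<partial>lborel) \<partial>lborel)"
    by (rule lborel_pair.Fubini') measurable
  also have "\<dots> = (\<integral>\<^sup>+x. ennreal (Beta (1/2 - b) b / 2) * (ennreal ((cosh ((t + x) / 2) powr (2 * b) +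
            cosh ((t - x) / 2) powr (2 * b)) * (m + cosh x) powr (- (b + c))) * indicator {0<..} x) \<partial>lborel)"
  proof (rule nn_integral_cong)
    fix x :: real
    show "(\<integral>\<^sup>+r. ennreal (\<phi> r * \<psi> x r * \<mu> x) * indicator {(x, r). 0 < r \<and> r < x} (x, r) \<partial>lborel)
        = ennreal (Beta (1/2 - b) b / 2) * (ennreal ((cosh ((t + x) / 2) powr (2 * b) +
            cosh ((t - x) / 2) powr (2 * b)) * (m + cosh x) powr (- (b + c))) * indicator {0<..} x)"
    proof (cases "0 < x")
      case True
      have "(\<integral>\<^sup>+r. ennreal (\<phi> r * \<psi> x r * \<mu> x) * indicator {(x, r). 0 < r \<and> r < x} (x, r) \<partial>lborel)
          = (\<integral>\<^sup>+r. ennreal (\<mu> x) * (ennreal (sinh r powr (- 2 * b) * (cosh t + cosh r) powr b *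
            (cosh x - cosh r) powr (b - 1) * sinh x) * indicator {0<..<x} r) \<partial>lborel)"
        using True nonneg(2)[of x]
        by (intro nn_integral_cong) (auto simp: \<psi>_def \<phi>_def mult_ac split: split_indicator simp flip: ennreal_mult')
      also have "\<dots> = ennreal (\<mu> x) * (\<integral>\<^sup>+r\<in>{0<..<x}. ennreal (sinh r powr (- 2 * b) * (cosh t + cosh r) powr b *
            (cosh x - cosh r) powr (b - 1) * sinh x) \<partial>lborel)"
        by (rule nn_integral_cmult) measurable
      also have "\<dots> = ennreal (\<mu> x) * ennreal (Beta (1/2 - b) b / 2 *
            (cosh ((t + x) / 2) powr (2 * b) + cosh ((t - x) / 2) powr (2 * b)))"
        by (subst nn_integral_cosh_binomial[OF b t True]) simp
      also have "\<dots> = ennreal (Beta (1/2 - b) b / 2) * ennreal ((cosh ((t + x) / 2) powr (2 * b) + cosh ((t - x) / 2) powr (2 * b)) * \<mu> x)"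
      proof -
        have "0 \<le> Beta (1/2 - b) b" using b by (simp add: Beta_def)
        thus ?thesis
          using nonneg(2)[of x] by (simp add: mult_ac flip: ennreal_mult' ennreal_mult'')
      qed
      finally show ?thesis using True by (simp add: \<mu>_def)
    next
      case False
      hence "(\<lambda>r. ennreal (\<phi> r * \<psi> x r * \<mu> x) * indicator {(x, r). 0 < r \<and> r < x} (x, r)) = (\<lambda>r. 0)"
        by (auto split: split_indicator)
      thus ?thesis using False by simp
    qed
  qed
  also have "\<dots> = ennreal (Beta (1/2 - b) b / 2) * (\<integral>\<^sup>+x\<in>{0<..}. ennreal ((cosh ((t + x) / 2) powr (2 * b) +
            cosh ((t - x) / 2) powr (2 * b)) * (m + cosh x) powr (- (b + c))) \<partial>lborel)"
    by (rule nn_integral_cmult) measurable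
  finally show ?thesis .
qed

section \<open>From half-lines to the whole plane\<close>

text \<open>Since \<open>cosh x\<close> is even, folding the line at 0 changes only the factor in
  \<open>t - x\<close>. This is how the sum of two cosh powers in
  \<open>nn_integral_cosh_kernel\<close> becomes a single one.\<close>

lemma nn_integral_symmetrize_cosh:
  fixes b d m t :: real
  shows "(\<integral>\<^sup>+x. ennreal (cosh ((t - x) / 2) powr (2 * b) * (m + cosh x) powr d) \<partial>lborel)
       = (\<integral>\<^sup>+x\<in>{0<..}. ennreal ((cosh ((t + x) / 2) powr (2 * b) +
            cosh ((t - x) / 2) powr (2 * b)) * (m + cosh x) powr d) \<partial>lborel)"
  by (subst nn_integral_symmetrize, measurable)
    (auto intro!: nn_integral_cong split: split_indicator simp: distrib_right add_ac simp flip: ennreal_plus)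

text \<open>\<open>nn_integral_cosh_kernel\<close> is applied for each \<open>t > 0\<close> with
  \<open>m = n * cosh t\<close> and integrated over \<open>t\<close>. The inner integral on the
  right is even in \<open>t\<close>, so extending \<open>t\<close> to the whole line doubles it;
  hence the divisor 4 in place of 2.\<close>

lemma nn_integral_cosh_kernel_plane:
  fixes b c n :: real
  assumes b: "0 < b" "b < 1/2" and c: "0 < c" and n: "0 \<le> n"
  shows "ennreal (Beta b c) * (\<integral>\<^sup>+t\<in>{0<..}. (\<integral>\<^sup>+r\<in>{0<..}. ennreal (sinh r powr (- 2 * b) *
            (cosh t + cosh r) powr b * (n * cosh t + cosh r) powr (- c)) \<partial>lborel) \<partial>lborel)
       = ennreal (Beta (1/2 - b) b / 4) * (\<integral>\<^sup>+t. (\<integral>\<^sup>+x. ennreal (cosh ((t - x) / 2) powr (2 * b) *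
            (n * cosh t + cosh x) powr (- (b + c))) \<partial>lborel) \<partial>lborel)"
proof -
  define G where "G t = (\<integral>\<^sup>+x. ennreal (cosh ((t - x) / 2) powr (2 * b) *
            (n * cosh t + cosh x) powr (- (b + c))) \<partial>lborel)" for t
  have [measurable]: "G \<in> borel_measurable borel"
    unfolding G_def[abs_def] by measurable
  have Beta_nonneg: "0 \<le> Beta (1/2 - b) b" using b by (simp add: Beta_def)
  \<comment> \<open>In the symmetrised form of \<open>G\<close>, a change of sign of
    \<open>t\<close> merely swaps the two cosh terms.\<close>
  have "G (- t) = G t" for t
  proof -
    have "(- t - x) / 2 = - ((t + x) / 2)" "(- t + x) / 2 = - ((t - x) / 2)" for x
      by (simp_all add: field_simps)
    thus ?thesis
      unfolding G_def nn_integral_symmetrize_cosh by (simp only: cosh_minus) (simp add: add.commute)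
  qed
  hence "ennreal (Beta (1/2 - b) b / 4) * (\<integral>\<^sup>+t. G t \<partial>lborel)
      = ennreal (Beta (1/2 - b) b / 4) * (\<integral>\<^sup>+t\<in>{0<..}. G t + G t \<partial>lborel)"
    by (subst nn_integral_symmetrize) simp_all
  also have "\<dots> = (\<integral>\<^sup>+t. ennreal (Beta (1/2 - b) b / 4) * ((G t + G t) * indicator {0<..} t) \<partial>lborel)"
    by (rule nn_integral_cmult[symmetric]) measurable
  also have "\<dots> = (\<integral>\<^sup>+t. ennreal (Beta (1/2 - b) b / 2) * (G t * indicator {0<..} t) \<partial>lborel)"
  proof (rule nn_integral_cong)
    fix t :: real
    have "ennreal (Beta (1/2 - b) b / 4) * (G t + G t)
        = (ennreal (Beta (1/2 - b) b / 4) + ennreal (Beta (1/2 - b) b / 4)) * G t"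
      by (simp add: distrib_left distrib_right)
    also have "ennreal (Beta (1/2 - b) b / 4) + ennreal (Beta (1/2 - b) b / 4) = ennreal (Beta (1/2 - b) b / 2)"
      using Beta_nonneg by (simp flip: ennreal_plus)
    finally show "ennreal (Beta (1/2 - b) b / 4) * ((G t + G t) * indicator {0<..} t)
        = ennreal (Beta (1/2 - b) b / 2) * (G t * indicator {0<..} t)"
      by (simp flip: mult.assoc)
  qed
  also have "\<dots> = (\<integral>\<^sup>+t. ennreal (Beta b c) * ((\<integral>\<^sup>+r\<in>{0<..}. ennreal (sinh r powr (- 2 * b) *
            (cosh t + cosh r) powr b * (n * cosh t + cosh r) powr (- c)) \<partial>lborel) * indicator {0<..} t) \<partial>lborel)"
  proof (rule nn_integral_cong)
    fix t :: real
    show "ennreal (Beta (1/2 - b) b / 2) * (G t * indicator {0<..} t)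
        = ennreal (Beta b c) * ((\<integral>\<^sup>+r\<in>{0<..}. ennreal (sinh r powr (- 2 * b) *
            (cosh t + cosh r) powr b * (n * cosh t + cosh r) powr (- c)) \<partial>lborel) * indicator {0<..} t)"
    proof (cases "0 < t")
      case True
      have "0 \<le> n * cosh t" using n by simp
      from nn_integral_cosh_kernel[OF b c this True] show ?thesis
        using True unfolding G_def nn_integral_symmetrize_cosh by simp
    qed simp
  qed
  also have "\<dots> = ennreal (Beta b c) * (\<integral>\<^sup>+t\<in>{0<..}. (\<integral>\<^sup>+r\<in>{0<..}. ennreal (sinh r powr (- 2 * b) *
            (cosh t + cosh r) powr b * (n * cosh t + cosh r) powr (- c)) \<partial>lborel) \<partial>lborel)"
    by (rule nn_integral_cmult) measurable
  finally show ?thesis by (simp add: G_def)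
qed

section \<open>The density of the sum\<close>

text \<open>The substitution is the logistic curve \<open>s / (1 + exp (- x))\<close>. With half
  arguments, the curve and its derivative have powers of \<open>2 * cosh (x / 2)\<close> as
  denominators, which suits the later product formulas.\<close>

lemma nn_integral_logistic:
  fixes f :: "real \<Rightarrow> ennreal" and s :: real
  assumes s: "0 < s" and [measurable]: "f \<in> borel_measurable borel"
  shows "(\<integral>\<^sup>+y\<in>{0<..<s}. f y \<partial>lborel)
       = (\<integral>\<^sup>+x. f (s * exp (x / 2) / (2 * cosh (x / 2))) * ennreal (s / (2 * cosh (x / 2))\<^sup>2) \<partial>lborel)"
proof -
  define g where "g x = s / (1 + exp (- x))" for x
  define g' where "g' x = s * exp (- x) / (1 + exp (- x))\<^sup>2" for x
  have pos: "0 < 1 + exp (- x)" for x :: real by (simp add: add_pos_pos)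
  have e: "1 + exp (- x) = 2 * cosh (x / 2) / exp (x / 2)" for x :: real
    by (simp add: cosh_def field_simps flip: exp_add)
  have e2: "exp (- x) = 1 / (exp (x / 2))\<^sup>2" for x :: real
    by (simp add: exp_minus field_simps flip: exp_of_nat_mult)
  have g_eq: "g x = s * exp (x / 2) / (2 * cosh (x / 2))" for x
    unfolding g_def e by simp
  have g'_eq: "g' x = s / (2 * cosh (x / 2))\<^sup>2" for x
    unfolding g'_def e unfolding e2 by (simp add: power_divide)
  have inj: "inj_on g UNIV"
    using s pos by (auto simp: inj_on_def g_def less_imp_neq[symmetric])
  have image: "g ` UNIV = {0<..<s}"
  proof (intro equalityI subsetI)
    fix y assume "y \<in> g ` UNIV"
    then obtain x where "y = g x" by auto
    moreover have "g x < s" using s pos[of x] by (simp add: g_def divide_less_eq)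
    ultimately show "y \<in> {0<..<s}" using s pos[of x] by (simp add: g_def)
  next
    fix y assume y: "y \<in> {0<..<s}"
    \<comment> \<open>The preimage of \<open>y\<close> is the scaled logit
      \<open>- ln (s / y - 1)\<close>.\<close>
    hence "exp (- (- ln (s / y - 1))) = s / y - 1" by (simp add: field_simps)
    hence "g (- ln (s / y - 1)) = y" using y by (simp add: g_def)
    thus "y \<in> g ` UNIV" by (metis rangeI)
  qed
  have deriv: "(g has_real_derivative g' x) (at x)" for x
  proof -
    have "1 + exp (- x) \<noteq> 0" using pos[of x] by simp
    thus ?thesis
      unfolding g_def g'_def by (auto intro!: derivative_eq_intros simp: power2_eq_square)
  qed
  have "(\<integral>\<^sup>+y\<in>{0<..<s}. f y \<partial>lborel) = (\<integral>\<^sup>+x\<in>UNIV. f (g x) * ennreal \<bar>g' x\<bar> \<partial>lborel)"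
    by (rule nn_integral_change_of_variables[OF _ _ image inj deriv])
      (use pos in \<open>auto simp: g'_def less_imp_neq[symmetric] intro!: continuous_intros\<close>)
  thus ?thesis using s by (simp add: g_eq g'_eq)
qed

text \<open>This is the symmetric Beta integral in logistic coordinates: the point and its
  complement are \<open>exp (x / 2)\<close> and \<open>exp (- x / 2)\<close> over
  \<open>2 * cosh (x / 2)\<close>, so the exponentials cancel in their product.\<close>

lemma nn_integral_cosh_powr:
  fixes k :: real
  assumes "0 < k"
  shows "(\<integral>\<^sup>+x. ennreal ((2 * cosh (x / 2)) powr (- 2 * k)) \<partial>lborel) = ennreal (Beta k k)"
proof -
  have "ennreal (Beta k k) = (\<integral>\<^sup>+t\<in>{0<..<1}. ennreal (t powr (k - 1) * (1 - t) powr (k - 1)) \<partial>lborel)"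
    using assms by (simp add: nn_integral_Beta)
  also have "\<dots> = (\<integral>\<^sup>+x. ennreal ((1 * exp (x / 2) / (2 * cosh (x / 2))) powr (k - 1) *
      (1 - 1 * exp (x / 2) / (2 * cosh (x / 2))) powr (k - 1)) * ennreal (1 / (2 * cosh (x / 2))\<^sup>2) \<partial>lborel)"
    by (rule nn_integral_logistic) auto
  also have "\<dots> = (\<integral>\<^sup>+x. ennreal ((2 * cosh (x / 2)) powr (- 2 * k)) \<partial>lborel)"
  proof (intro nn_integral_cong)
    fix x :: real
    define h e where "h = 2 * cosh (x / 2)" and "e = exp (x / 2)"
    have pos: "0 < h" "0 < e" by (simp_all add: h_def e_def)
    have h_e: "h = e + inverse e"
      by (simp add: h_def e_def cosh_def exp_minus)
    have "1 - e / h = inverse e / h" using pos by (simp add: field_simps) (simp add: h_e algebra_simps)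
    hence "(e / h) powr (k - 1) * (1 - e / h) powr (k - 1) = ((e / h) * (inverse e / h)) powr (k - 1)"
      using pos by (subst powr_mult) auto
    also have "(e / h) * (inverse e / h) = h powr (-2)"
      using pos by (simp add: powr_minus powr_numeral field_simps power2_eq_square)
    also have "(h powr (-2)) powr (k - 1) = h powr (-2 * k) * h\<^sup>2"
    proof -
      have "h\<^sup>2 = h powr 2" using pos by (simp add: powr_numeral)
      thus ?thesis by (simp only: powr_powr flip: powr_add) (simp add: algebra_simps)
    qed
    finally show "ennreal ((1 * exp (x / 2) / (2 * cosh (x / 2))) powr (k - 1) *
        (1 - 1 * exp (x / 2) / (2 * cosh (x / 2))) powr (k - 1)) * ennreal (1 / (2 * cosh (x / 2))\<^sup>2)
        = ennreal ((2 * cosh (x / 2)) powr (- 2 * k))"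
      using pos unfolding h_def[symmetric] e_def[symmetric] by (simp flip: ennreal_mult'')
  qed
  finally show ?thesis ..
qed

text \<open>Feynman's formula in logarithmic form: a power of the product \<open>p * q\<close> is
  traded for an integral of powers of a linear form in \<open>p\<close> and \<open>q\<close>.
  Translation by \<open>ln (q / p)\<close> balances both coefficients to \<open>sqrt (p * q)\<close>
  and leaves \<open>nn_integral_cosh_powr\<close>.\<close>

lemma nn_integral_Feynman:
  fixes k p q :: real
  assumes "0 < k" "0 < p" "0 < q"
  shows "(\<integral>\<^sup>+x. ennreal ((p * exp (x / 2) + q * exp (- x / 2)) powr (- 2 * k)) \<partial>lborel)
       = ennreal (Beta k k * (p * q) powr (- k))"
proof -
  define c where "c = ln (q / p)"
  have expc: "p * exp (c / 2) = sqrt (p * q)" "q * exp (- c / 2) = sqrt (p * q)"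
  proof -
    have sqrt_eq: "x * sqrt (y / x) = sqrt (x * y)" if "0 < x" for x y :: real
    proof -
      have "sqrt (x * y) = sqrt (x\<^sup>2 * (y / x))" using that by (simp add: power2_eq_square)
      also have "\<dots> = x * sqrt (y / x)" using that by (subst real_sqrt_mult) simp
      finally show ?thesis ..
    qed
    have exp_c: "exp (c / 2) = sqrt (q / p)" using assms by (simp add: c_def ln_sqrt[symmetric])
    have "exp (- c / 2) = sqrt (p / q)"
      using exp_c by (simp add: exp_minus real_sqrt_divide)
    with exp_c show "p * exp (c / 2) = sqrt (p * q)" "q * exp (- c / 2) = sqrt (p * q)"
      using assms sqrt_eq[of p q] sqrt_eq[of q p] by (simp_all only:) (simp_all add: mult.commute)
  qed
  \<comment> \<open>The unit factor in \<open>c + 1 * x\<close> keeps the shape produced by the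
    affine substitution rule.\<close>
  have "p * exp ((c + 1 * x) / 2) + q * exp (- (c + 1 * x) / 2) = sqrt (p * q) * (2 * cosh (x / 2))" for x
  proof -
    have "(c + 1 * x) / 2 = c / 2 + x / 2" "- (c + 1 * x) / 2 = - c / 2 + - (x / 2)"
      by (simp_all add: field_simps)
    hence "p * exp ((c + 1 * x) / 2) + q * exp (- (c + 1 * x) / 2)
        = (p * exp (c / 2)) * exp (x / 2) + (q * exp (- c / 2)) * exp (- (x / 2))"
      by (simp only: exp_add mult.assoc)
    thus ?thesis by (simp only: expc) (simp add: cosh_def algebra_simps)
  qed
  hence eq: "(p * exp ((c + 1 * x) / 2) + q * exp (- (c + 1 * x) / 2)) powr (- 2 * k)
      = (p * q) powr (- k) * (2 * cosh (x / 2)) powr (- 2 * k)" for x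
    using assms by (simp only:) (simp add: powr_mult powr_powr flip: powr_half_sqrt)
  have "(\<integral>\<^sup>+x. ennreal ((p * exp (x / 2) + q * exp (- x / 2)) powr (- 2 * k)) \<partial>lborel)
      = (\<integral>\<^sup>+x. ennreal ((p * exp ((c + 1 * x) / 2) + q * exp (- (c + 1 * x) / 2)) powr (- 2 * k)) \<partial>lborel)"
    by (subst nn_integral_real_affine[where c = 1 and t = c]) auto
  also have "\<dots> = (\<integral>\<^sup>+x. ennreal ((p * q) powr (- k)) * ennreal ((2 * cosh (x / 2)) powr (- 2 * k)) \<partial>lborel)"
    by (simp only: eq) (simp add: ennreal_mult')
  also have "\<dots> = ennreal ((p * q) powr (- k)) * (\<integral>\<^sup>+x. ennreal ((2 * cosh (x / 2)) powr (- 2 * k)) \<partial>lborel)"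
    by (rule nn_integral_cmult) measurable
  also have "\<dots> = ennreal (Beta k k * (p * q) powr (- k))"
    by (subst nn_integral_cosh_powr[OF assms(1)]) (simp add: ennreal_mult'' mult.commute)
  finally show ?thesis .
qed

text \<open>The map from \<open>(t, x)\<close> to \<open>(t - x, t + x)\<close> has determinant 2.
  It is carried out as two affine substitutions in one variable with an exchange of integrals
  between them.\<close>

lemma nn_integral_rotate_plane:
  fixes \<Phi> :: "real \<Rightarrow> real \<Rightarrow> ennreal"
  assumes [measurable]: "(\<lambda>(t, x). \<Phi> t x) \<in> borel_measurable (borel \<Otimes>\<^sub>M borel)"
  shows "(\<integral>\<^sup>+y. (\<integral>\<^sup>+z. \<Phi> ((y + z) / 2) ((z - y) / 2) \<partial>lborel) \<partial>lborel) = 2 * (\<integral>\<^sup>+t. (\<integral>\<^sup>+x. \<Phi> t x \<partial>lborel) \<partial>lborel)"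
proof -
  have "(\<integral>\<^sup>+y. (\<integral>\<^sup>+z. \<Phi> ((y + z) / 2) ((z - y) / 2) \<partial>lborel) \<partial>lborel)
      = (\<integral>\<^sup>+y. (\<integral>\<^sup>+t. 2 * \<Phi> t (t - y) \<partial>lborel) \<partial>lborel)"
  proof (rule nn_integral_cong)
    fix y :: real
    have "(\<integral>\<^sup>+z. \<Phi> ((y + z) / 2) ((z - y) / 2) \<partial>lborel)
        = ennreal \<bar>2\<bar> * (\<integral>\<^sup>+t. \<Phi> ((y + (- y + 2 * t)) / 2) ((- y + 2 * t - y) / 2) \<partial>lborel)"
      by (rule nn_integral_real_affine) auto
    also have "\<dots> = 2 * (\<integral>\<^sup>+t. \<Phi> t (t - y) \<partial>lborel)"
    proof -
      have "(y + (- y + 2 * t)) / 2 = t" "(- y + 2 * t - y) / 2 = t - y" for t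
        by (simp_all add: field_simps)
      thus ?thesis by (simp only:) simp
    qed
    also have "\<dots> = (\<integral>\<^sup>+t. 2 * \<Phi> t (t - y) \<partial>lborel)"
      by (rule nn_integral_cmult[symmetric]) measurable
    finally show "(\<integral>\<^sup>+z. \<Phi> ((y + z) / 2) ((z - y) / 2) \<partial>lborel) = (\<integral>\<^sup>+t. 2 * \<Phi> t (t - y) \<partial>lborel)" .
  qed
  also have "\<dots> = (\<integral>\<^sup>+t. (\<integral>\<^sup>+y. 2 * \<Phi> t (t - y) \<partial>lborel) \<partial>lborel)"
    by (rule lborel_pair.Fubini') measurable
  also have "\<dots> = (\<integral>\<^sup>+t. 2 * (\<integral>\<^sup>+x. \<Phi> t x \<partial>lborel) \<partial>lborel)"
  proof (rule nn_integral_cong)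
    fix t :: real
    have "(\<integral>\<^sup>+y. 2 * \<Phi> t (t - y) \<partial>lborel) = ennreal \<bar>-1\<bar> * (\<integral>\<^sup>+x. 2 * \<Phi> t (t - (t + (-1) * x)) \<partial>lborel)"
      by (rule nn_integral_real_affine) auto
    also have "\<dots> = 2 * (\<integral>\<^sup>+x. \<Phi> t x \<partial>lborel)"
      by simp (rule nn_integral_cmult, measurable)
    finally show "(\<integral>\<^sup>+y. 2 * \<Phi> t (t - y) \<partial>lborel) = 2 * (\<integral>\<^sup>+x. \<Phi> t x \<partial>lborel)" .
  qed
  also have "\<dots> = 2 * (\<integral>\<^sup>+t. (\<integral>\<^sup>+x. \<Phi> t x \<partial>lborel) \<partial>lborel)"
    by (rule nn_integral_cmult) measurable
  finally show ?thesis .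
qed

text \<open>The factor \<open>Beta (a + b) (a + b)\<close> is the constant of Feynman's formula,
  kept on the left so that no division is made. The exponent \<open>b + (2 * a + b)\<close> has the
  shape \<open>b + c\<close> of the kernel identity with \<open>c = 2 * a + b\<close>.\<close>

lemma nn_integral_betaprime_convolution:
  fixes a b s :: real
  assumes a: "0 < a" and b: "0 < b" and s: "0 < s"
  shows "ennreal (Beta (a + b) (a + b)) *
         (\<integral>\<^sup>+y. ennreal (betaprime_density a b (s - y)) * ennreal (betaprime_density a b y) \<partial>lborel)
       = ennreal (2 * (Gamma (a + b) / (Gamma a * Gamma b))\<^sup>2 * 2 powr (- 2 * a) * s powr (2 * a - 1)) *
         (\<integral>\<^sup>+t. (\<integral>\<^sup>+x. ennreal (cosh ((t - x) / 2) powr (2 * b) *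
            ((1 + s) * cosh t + cosh x) powr (- (b + (2 * a + b)))) \<partial>lborel) \<partial>lborel)"
proof -
  define C where "C = Gamma (a + b) / (Gamma a * Gamma b)"
  define K where "K = C\<^sup>2 * 2 powr (- 2 * a) * s powr (2 * a - 1)"
  define \<Phi> where "\<Phi> t x = cosh ((t - x) / 2) powr (2 * b) *
            ((1 + s) * cosh t + cosh x) powr (- (b + (2 * a + b)))" for t x
  \<comment> \<open>\<open>p\<close> and \<open>q\<close> are what \<open>1 + y\<close> and
    \<open>1 + s - y\<close> become under the logistic substitution.\<close>
  define p where "p y = 1 + s * exp (y / 2) / (2 * cosh (y / 2))" for y
  define q where "q y = 1 + s * exp (- (y / 2)) / (2 * cosh (y / 2))" for y
  have [measurable]: "(\<lambda>(t, x). \<Phi> t x) \<in> borel_measurable (borel \<Otimes>\<^sub>M borel)"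
    unfolding \<Phi>_def by measurable
  have C: "0 < C" using a b by (simp add: C_def)
  have K: "0 \<le> K" by (simp add: K_def)
  have p: "0 < p y" and q: "0 < q y" for y
    using s by (auto simp: p_def q_def intro!: add_pos_pos)
  have feynman: "ennreal (Beta (a + b) (a + b)) * ennreal ((p y * q y) powr (- (a + b)))
      = (\<integral>\<^sup>+z. ennreal ((2 * ((1 + s) * cosh ((y + z) / 2) + cosh ((z - y) / 2)) / (2 * cosh (y / 2))) powr (- 2 * (a + b))) \<partial>lborel)" for y
  proof -
    have "p y * exp (z / 2) + q y * exp (- z / 2)
        = 2 * ((1 + s) * cosh ((y + z) / 2) + cosh ((z - y) / 2)) / (2 * cosh (y / 2))" for z
    proof -
      define e d where "e = exp (y / 2)" and "d = exp (z / 2)"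
      have pos: "0 < e" "0 < d" by (simp_all add: e_def d_def)
      have "(y + z) / 2 = y / 2 + z / 2" "(z - y) / 2 = z / 2 - y / 2" by (simp_all add: field_simps)
      hence "exp ((y + z) / 2) = e * d" "exp ((z - y) / 2) = d / e"
        by (simp_all only: exp_add exp_diff e_def d_def)
      hence "2 * cosh ((y + z) / 2) = e * d + 1 / (e * d)" "2 * cosh ((z - y) / 2) = d / e + e / d"
        unfolding cosh_def exp_minus by (simp_all add: inverse_eq_divide mult.commute)
      moreover have c: "2 * cosh (y / 2) = e + 1 / e" by (simp add: cosh_def e_def exp_minus field_simps)
      moreover have "p y * exp (z / 2) + q y * exp (- z / 2)
          = (2 * cosh (y / 2) * (d + 1 / d) + s * (e * d + 1 / (e * d))) / (2 * cosh (y / 2))"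
      proof -
        have "exp (- z / 2) = 1 / d" "exp (- (y / 2)) = 1 / e" by (simp_all add: d_def e_def exp_minus field_simps)
        thus ?thesis using pos
          by (simp add: p_def q_def flip: e_def d_def) (simp add: field_simps)
      qed
      \<comment> \<open>Product formula for \<open>2 * cosh (y / 2)\<close> and
        \<open>2 * cosh (z / 2)\<close>. The terms with \<open>s\<close> only add to
        \<open>cosh ((y + z) / 2)\<close>, so its coefficient becomes \<open>1 + s\<close> and that
        of \<open>cosh ((z - y) / 2)\<close> stays 1.\<close>
      moreover have "(e + 1 / e) * (d + 1 / d) = (e * d + 1 / (e * d)) + (d / e + e / d)"
        using pos by (simp add: field_simps)
      ultimately show ?thesis by (simp add: algebra_simps)
    qed
    hence "(\<integral>\<^sup>+z. ennreal ((2 * ((1 + s) * cosh ((y + z) / 2) + cosh ((z - y) / 2)) / (2 * cosh (y / 2))) powr (- 2 * (a + b))) \<partial>lborel)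
      = (\<integral>\<^sup>+z. ennreal ((p y * exp (z / 2) + q y * exp (- z / 2)) powr (- 2 * (a + b))) \<partial>lborel)"
      by simp
    also have "\<dots> = ennreal (Beta (a + b) (a + b) * (p y * q y) powr (- (a + b)))"
      using a b p q by (intro nn_integral_Feynman) auto
    finally show ?thesis by (simp add: ennreal_mult'')
  qed
  have "(\<integral>\<^sup>+y. ennreal (betaprime_density a b (s - y)) * ennreal (betaprime_density a b y) \<partial>lborel)
      = (\<integral>\<^sup>+y\<in>{0<..<s}. ennreal (C\<^sup>2 * ((s - y) powr (a - 1) * y powr (a - 1) *
          ((1 + y) * (1 + (s - y))) powr (- (a + b)))) \<partial>lborel)"
  proof (rule nn_integral_cong)
    fix y :: real
    have density: "betaprime_density a b x = C * (x powr (a - 1) * (1 + x) powr (- (a + b)))" if "0 < x" for x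
      using that unfolding betaprime_density_def powr_minus_divide by (simp add: C_def)
    show "ennreal (betaprime_density a b (s - y)) * ennreal (betaprime_density a b y)
        = ennreal (C\<^sup>2 * ((s - y) powr (a - 1) * y powr (a - 1) *
          ((1 + y) * (1 + (s - y))) powr (- (a + b)))) * indicator {0<..<s} y"
    proof (cases "y \<in> {0<..<s}")
      case True
      hence "((1 + y) * (1 + (s - y))) powr (- (a + b)) = (1 + y) powr (- (a + b)) * (1 + (s - y)) powr (- (a + b))"
        by (intro powr_mult)
      hence "betaprime_density a b (s - y) * betaprime_density a b y
          = C\<^sup>2 * ((s - y) powr (a - 1) * y powr (a - 1) * ((1 + y) * (1 + (s - y))) powr (- (a + b)))"
        using True by (simp add: density power2_eq_square)
      moreover have "0 \<le> betaprime_density a b (s - y)" using True C by (simp add: density)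
      ultimately show ?thesis using True by (simp flip: ennreal_mult')
    qed (auto simp: betaprime_density_def)
  qed
  also have "\<dots> = (\<integral>\<^sup>+y. ennreal (C\<^sup>2 * ((s - s * exp (y / 2) / (2 * cosh (y / 2))) powr (a - 1) *
        (s * exp (y / 2) / (2 * cosh (y / 2))) powr (a - 1) *
          ((1 + s * exp (y / 2) / (2 * cosh (y / 2))) * (1 + (s - s * exp (y / 2) / (2 * cosh (y / 2))))) powr (- (a + b)))) *
        ennreal (s / (2 * cosh (y / 2))\<^sup>2) \<partial>lborel)"
    by (rule nn_integral_logistic[OF s]) measurable
  also have "\<dots> = (\<integral>\<^sup>+y. ennreal (C\<^sup>2 * s powr (2 * a - 1) * (2 * cosh (y / 2)) powr (- 2 * a)) *
        ennreal ((p y * q y) powr (- (a + b))) \<partial>lborel)"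
  proof (rule nn_integral_cong)
    fix y :: real
    define h e where "h = 2 * cosh (y / 2)" and "e = exp (y / 2)"
    have pos: "0 < h" "0 < e" by (simp_all add: h_def e_def)
    have h_e: "h = e + 1 / e"
      by (simp add: h_def e_def cosh_def exp_minus field_simps)
    have compl: "s - s * e / h = s * (1 / e) / h"
      using pos by (simp add: field_simps) (simp add: h_e field_simps)
    \<comment> \<open>The powers of \<open>e\<close> cancel between the two reflected points; the
      exponent of \<open>s\<close> is \<open>2 * (a - 1) + 1\<close> and that of \<open>h\<close> is
      \<open>- 2 * (a - 1) - 2\<close>.\<close>
    have exps: "(s * (1 / e) / h) powr (a - 1) * (s * e / h) powr (a - 1) * (s / h\<^sup>2)
        = s powr (2 * a - 1) * h powr (- 2 * a)"
    proof -
      obtain s' h' e' where exps: "s = exp s'" "h = exp h'" "e = exp e'"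
        by (rule that[of "ln s" "ln h" "ln e"]) (simp_all add: pos s)
      have exp_powr: "exp x powr y = exp (y * x)" for x y :: real by (simp add: powr_def)
      show ?thesis unfolding exps
        by (simp only: exp_powr power2_eq_square divide_inverse mult_1_left flip: exp_add exp_minus)
          (simp add: algebra_simps)
    qed
    have "p y = 1 + s * e / h" "q y = 1 + s * (1 / e) / h"
      by (simp_all add: p_def q_def h_def e_def exp_minus field_simps)
    hence "C\<^sup>2 * ((s - s * e / h) powr (a - 1) * (s * e / h) powr (a - 1) *
          ((1 + s * e / h) * (1 + (s - s * e / h))) powr (- (a + b))) * (s / h\<^sup>2)
        = C\<^sup>2 * ((s * (1 / e) / h) powr (a - 1) * (s * e / h) powr (a - 1) * (s / h\<^sup>2)) * (p y * q y) powr (- (a + b))"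
      unfolding compl by simp
    also have "\<dots> = C\<^sup>2 * s powr (2 * a - 1) * h powr (- 2 * a) * (p y * q y) powr (- (a + b))"
      unfolding exps by simp
    finally show "ennreal (C\<^sup>2 * ((s - s * exp (y / 2) / (2 * cosh (y / 2))) powr (a - 1) *
        (s * exp (y / 2) / (2 * cosh (y / 2))) powr (a - 1) *
          ((1 + s * exp (y / 2) / (2 * cosh (y / 2))) * (1 + (s - s * exp (y / 2) / (2 * cosh (y / 2))))) powr (- (a + b)))) *
        ennreal (s / (2 * cosh (y / 2))\<^sup>2)
      = ennreal (C\<^sup>2 * s powr (2 * a - 1) * (2 * cosh (y / 2)) powr (- 2 * a)) *
        ennreal ((p y * q y) powr (- (a + b)))"
      unfolding h_def[symmetric] e_def[symmetric] using s by (simp flip: ennreal_mult' ennreal_mult'')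
  qed
  finally have "ennreal (Beta (a + b) (a + b)) *
         (\<integral>\<^sup>+y. ennreal (betaprime_density a b (s - y)) * ennreal (betaprime_density a b y) \<partial>lborel)
      = ennreal (Beta (a + b) (a + b)) * (\<integral>\<^sup>+y. ennreal (C\<^sup>2 * s powr (2 * a - 1) * (2 * cosh (y / 2)) powr (- 2 * a)) *
        ennreal ((p y * q y) powr (- (a + b))) \<partial>lborel)" by simp
  also have "\<dots> = (\<integral>\<^sup>+y. ennreal (Beta (a + b) (a + b)) * (ennreal (C\<^sup>2 * s powr (2 * a - 1) * (2 * cosh (y / 2)) powr (- 2 * a)) *
        ennreal ((p y * q y) powr (- (a + b)))) \<partial>lborel)"
    by (rule nn_integral_cmult[symmetric]) (unfold p_def q_def, measurable)
  also have "\<dots> = (\<integral>\<^sup>+y. (\<integral>\<^sup>+z. ennreal K * ennreal (\<Phi> ((y + z) / 2) ((z - y) / 2)) \<partial>lborel) \<partial>lborel)"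
  proof (rule nn_integral_cong)
    fix y :: real
    define h where "h = 2 * cosh (y / 2)"
    have h: "0 < h" by (simp add: h_def)
    have "ennreal (Beta (a + b) (a + b)) * (ennreal (C\<^sup>2 * s powr (2 * a - 1) * h powr (- 2 * a)) *
        ennreal ((p y * q y) powr (- (a + b))))
      = ennreal (C\<^sup>2 * s powr (2 * a - 1) * h powr (- 2 * a)) *
        (\<integral>\<^sup>+z. ennreal ((2 * ((1 + s) * cosh ((y + z) / 2) + cosh ((z - y) / 2)) / h) powr (- 2 * (a + b))) \<partial>lborel)"
      unfolding feynman[of y, folded h_def, symmetric] by (simp add: mult_ac)
    also have "\<dots> = (\<integral>\<^sup>+z. ennreal (C\<^sup>2 * s powr (2 * a - 1) * h powr (- 2 * a)) *
        ennreal ((2 * ((1 + s) * cosh ((y + z) / 2) + cosh ((z - y) / 2)) / h) powr (- 2 * (a + b))) \<partial>lborel)"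
      by (rule nn_integral_cmult[symmetric]) measurable
    also have "\<dots> = (\<integral>\<^sup>+z. ennreal K * ennreal (\<Phi> ((y + z) / 2) ((z - y) / 2)) \<partial>lborel)"
    proof (rule nn_integral_cong)
      fix z :: real
      define m where "m = (1 + s) * cosh ((y + z) / 2) + cosh ((z - y) / 2)"
      have m: "0 < m" using s by (auto simp: m_def intro!: add_pos_pos mult_pos_pos)
      \<comment> \<open>The powers of \<open>h\<close> combine to exponent \<open>2 * b\<close>, and
        \<open>h / 2\<close> is \<open>cosh (y / 2)\<close>, where \<open>y\<close> is the
        difference of the rotated coordinates. The variable \<open>n\<close> stands for 2, whose
        remaining power goes into \<open>K\<close>.\<close>
      have eq: "h powr (- 2 * a) * (n * m / h) powr (- 2 * (a + b))
          = n powr (- 2 * a) * ((h / n) powr (2 * b) * m powr (- (b + (2 * a + b))))" if n: "0 < n" for n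
      proof -
        obtain n' h' m' where exps: "n = exp n'" "h = exp h'" "m = exp m'"
          by (rule that[of "ln n" "ln h" "ln m"]) (simp_all add: h m n)
        have exp_powr: "exp x powr y = exp (y * x)" for x y :: real by (simp add: powr_def)
        show ?thesis unfolding exps
          by (simp only: exp_powr divide_inverse flip: exp_add exp_minus)
            (simp add: algebra_simps)
      qed
      have "((y + z) / 2 - (z - y) / 2) / 2 = y / 2" by (simp add: field_simps)
      hence "\<Phi> ((y + z) / 2) ((z - y) / 2) = (h / 2) powr (2 * b) * m powr (- (b + (2 * a + b)))"
        by (simp only: \<Phi>_def m_def h_def) simp
      hence "C\<^sup>2 * s powr (2 * a - 1) * (h powr (- 2 * a) * (2 * m / h) powr (- 2 * (a + b)))
          = K * \<Phi> ((y + z) / 2) ((z - y) / 2)"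
        unfolding eq[OF zero_less_numeral] by (simp add: K_def)
      thus "ennreal (C\<^sup>2 * s powr (2 * a - 1) * h powr (- 2 * a)) *
          ennreal ((2 * ((1 + s) * cosh ((y + z) / 2) + cosh ((z - y) / 2)) / h) powr (- 2 * (a + b)))
        = ennreal K * ennreal (\<Phi> ((y + z) / 2) ((z - y) / 2))"
        unfolding m_def[symmetric] using K by (simp add: mult.assoc flip: ennreal_mult' ennreal_mult'')
    qed
    finally show "ennreal (Beta (a + b) (a + b)) * (ennreal (C\<^sup>2 * s powr (2 * a - 1) * (2 * cosh (y / 2)) powr (- 2 * a)) *
        ennreal ((p y * q y) powr (- (a + b)))) = (\<integral>\<^sup>+z. ennreal K * ennreal (\<Phi> ((y + z) / 2) ((z - y) / 2)) \<partial>lborel)"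
      unfolding h_def .
  qed
  also have "\<dots> = 2 * (\<integral>\<^sup>+t. (\<integral>\<^sup>+x. ennreal K * ennreal (\<Phi> t x) \<partial>lborel) \<partial>lborel)"
    by (rule nn_integral_rotate_plane) measurable
  also have "\<dots> = 2 * (\<integral>\<^sup>+t. ennreal K * (\<integral>\<^sup>+x. ennreal (\<Phi> t x) \<partial>lborel) \<partial>lborel)"
    by (subst nn_integral_cmult) auto
  also have "\<dots> = 2 * (ennreal K * (\<integral>\<^sup>+t. (\<integral>\<^sup>+x. ennreal (\<Phi> t x) \<partial>lborel) \<partial>lborel))"
    by (subst nn_integral_cmult) auto
  also have "\<dots> = ennreal (2 * K) * (\<integral>\<^sup>+t. (\<integral>\<^sup>+x. ennreal (\<Phi> t x) \<partial>lborel) \<partial>lborel)"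
    using K by (simp add: ennreal_mult' mult.assoc)
  finally show ?thesis unfolding K_def \<Phi>_def C_def by (simp add: mult.assoc)
qed

section \<open>The density of the product\<close>

text \<open>In this coordinate \<open>1 - u\<close> is the square of \<open>tanh t\<close>, and the
  square root of a ratio of two such variables becomes a ratio of cosh values.\<close>

lemma nn_integral_sech_square:
  fixes f :: "real \<Rightarrow> ennreal"
  assumes [measurable]: "f \<in> borel_measurable borel"
  shows "(\<integral>\<^sup>+u\<in>{0<..<1}. f u \<partial>lborel)
       = (\<integral>\<^sup>+t\<in>{0<..}. f (1 / (cosh t)\<^sup>2) * ennreal (2 * sinh t / cosh t ^ 3) \<partial>lborel)"
proof -
  define g where "g t = 1 / (cosh t)\<^sup>2" for t :: real
  define g' where "g' t = - 2 * sinh t / cosh t ^ 3" for t :: real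
  have less: "1 < cosh t" if "0 < t" for t :: real
    using that cosh_real_nonneg_less_iff[of 0 t] by simp
  have inj: "inj_on g {0<..}"
  proof (rule inj_onI)
    fix x y :: real assume *: "x \<in> {0<..}" "y \<in> {0<..}" "g x = g y"
    hence "(cosh x)\<^sup>2 = (cosh y)\<^sup>2" by (simp add: g_def)
    hence "cosh x = cosh y" by (subst (asm) power2_eq_iff_nonneg) auto
    thus "x = y"
      using * cosh_real_nonneg_less_iff[of x y] cosh_real_nonneg_less_iff[of y x] by auto
  qed
  have image: "g ` {0<..} = {0<..<1}"
  proof (intro equalityI subsetI)
    fix y assume "y \<in> g ` {0<..}"
    then obtain t where t: "0 < t" "y = g t" by auto
    moreover have "1 < (cosh t)\<^sup>2" using less[OF t(1)] by (simp add: one_less_power)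
    ultimately show "y \<in> {0<..<1}" by (simp add: g_def)
  next
    fix y :: real assume y: "y \<in> {0<..<1}"
    \<comment> \<open>\<open>z\<close> is the value of \<open>cosh t\<close> that solves
      \<open>g t = y\<close>.\<close>
    define z where "z = 1 / sqrt y"
    have z: "1 < z" using y by (simp add: z_def)
    hence c: "cosh (arcosh z) = z" "0 \<le> arcosh z" by (auto intro!: cosh_arcosh_real)
    have "arcosh z \<noteq> 0" using c z by (metis cosh_0 less_irrefl)
    hence "0 < arcosh z" using c by simp
    moreover have "g (arcosh z) = y" using y by (simp add: g_def c z_def power_divide)
    ultimately show "y \<in> g ` {0<..}" by force
  qed
  have deriv: "(g has_real_derivative g' t) (at t)" for t
    unfolding g_def g'_def
    by (auto intro!: derivative_eq_intros simp: power2_eq_square power3_eq_cube field_simps)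
  have "(\<integral>\<^sup>+u\<in>{0<..<1}. f u \<partial>lborel) = (\<integral>\<^sup>+t\<in>{0<..}. f (g t) * ennreal \<bar>g' t\<bar> \<partial>lborel)"
    by (rule nn_integral_change_of_variables[OF _ _ image inj deriv])
      (auto simp: g'_def intro!: continuous_intros)
  also have "\<dots> = (\<integral>\<^sup>+t\<in>{0<..}. f (1 / (cosh t)\<^sup>2) * ennreal (2 * sinh t / cosh t ^ 3) \<partial>lborel)"
    by (intro nn_integral_cong) (auto split: split_indicator simp: g_def g'_def abs_mult abs_divide)
  finally show ?thesis .
qed

lemma beta_density_measurable [measurable]: "beta_density p q \<in> borel_measurable borel"
  unfolding beta_density_def[abs_def] by measurable

lemma betaprime_density_measurable [measurable]: "betaprime_density p q \<in> borel_measurable borel"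
  unfolding betaprime_density_def[abs_def] by measurable

text \<open>The beta density turns into a product of powers of cosh and sinh. For parameters
  \<open>a\<close>, \<open>1/2\<close> the exponent of sinh is 0, and for \<open>b\<close>,
  \<open>1/2 - b\<close> that of cosh is 0, so each of the two beta variables contributes a single
  power.\<close>

lemma nn_integral_beta_density_sech_square:
  fixes f :: "real \<Rightarrow> ennreal"
  assumes "0 < p" "0 < q" and [measurable]: "f \<in> borel_measurable borel"
  shows "(\<integral>\<^sup>+u. ennreal (beta_density p q u) * f u \<partial>lborel)
       = (\<integral>\<^sup>+t\<in>{0<..}. ennreal (2 * Gamma (p + q) / (Gamma p * Gamma q) * cosh t powr (1 - 2 * (p + q)) *
            sinh t powr (2 * q - 1)) * f (1 / (cosh t)\<^sup>2) \<partial>lborel)"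
proof -
  define C where "C = Gamma (p + q) / (Gamma p * Gamma q)"
  have C: "0 < C" using assms by (simp add: C_def)
  have "(\<integral>\<^sup>+u. ennreal (beta_density p q u) * f u \<partial>lborel)
      = (\<integral>\<^sup>+u\<in>{0<..<1}. ennreal (C * (u powr (p - 1) * (1 - u) powr (q - 1))) * f u \<partial>lborel)"
    by (intro nn_integral_cong) (auto simp: beta_density_def C_def mult.assoc split: split_indicator)
  also have "\<dots> = (\<integral>\<^sup>+t\<in>{0<..}. ennreal (C * ((1 / (cosh t)\<^sup>2) powr (p - 1) * (1 - 1 / (cosh t)\<^sup>2) powr (q - 1))) *
      f (1 / (cosh t)\<^sup>2) * ennreal (2 * sinh t / cosh t ^ 3) \<partial>lborel)"
    by (rule nn_integral_sech_square) measurable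
  also have "\<dots> = (\<integral>\<^sup>+t\<in>{0<..}. ennreal (2 * C * cosh t powr (1 - 2 * (p + q)) *
            sinh t powr (2 * q - 1)) * f (1 / (cosh t)\<^sup>2) \<partial>lborel)"
  proof (rule nn_integral_cong)
    fix t :: real
    have eq: "(1 / (cosh t)\<^sup>2) powr (p - 1) * (1 - 1 / (cosh t)\<^sup>2) powr (q - 1) * (sinh t / cosh t ^ 3)
       = cosh t powr (1 - 2 * (p + q)) * sinh t powr (2 * q - 1)" if "0 < t"
    proof -
      have "1 - 1 / (cosh t)\<^sup>2 = (sinh t)\<^sup>2 / (cosh t)\<^sup>2"
        by (simp add: sinh_square_eq diff_divide_distrib)
      moreover obtain s c where exps: "sinh t = exp s" "cosh t = exp c"
        by (rule that[of "ln (sinh t)" "ln (cosh t)"]) (simp_all add: \<open>0 < t\<close>)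
      moreover have exp_powr: "exp x powr y = exp (y * x)" for x y :: real by (simp add: powr_def)
      ultimately show ?thesis
        by (simp only: exp_powr power2_eq_square power3_eq_cube divide_inverse mult_1_left flip: exp_add exp_minus)
          (simp add: algebra_simps)
    qed
    have "C * ((1 / (cosh t)\<^sup>2) powr (p - 1) * (1 - 1 / (cosh t)\<^sup>2) powr (q - 1)) * (2 * sinh t / cosh t ^ 3)
        = 2 * C * cosh t powr (1 - 2 * (p + q)) * sinh t powr (2 * q - 1)" if "0 < t"
    proof -
      have *: "C * (A * B) * (2 * S / D) = 2 * C * (A * B * (S / D))" for A B S D :: real by simp
      show ?thesis unfolding * eq[OF that] by (rule mult.assoc[symmetric])
    qed
    thus "ennreal (C * ((1 / (cosh t)\<^sup>2) powr (p - 1) * (1 - 1 / (cosh t)\<^sup>2) powr (q - 1))) *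
        f (1 / (cosh t)\<^sup>2) * ennreal (2 * sinh t / cosh t ^ 3) * indicator {0<..} t
      = ennreal (2 * C * cosh t powr (1 - 2 * (p + q)) * sinh t powr (2 * q - 1)) * f (1 / (cosh t)\<^sup>2) * indicator {0<..} t"
      using C by (auto split: split_indicator simp: mult_ac simp flip: ennreal_mult')
  qed
  finally show ?thesis by (simp add: C_def)
qed

text \<open>With \<open>n\<close> and \<open>m\<close> as in the proof, the scale is
  \<open>n / cosh t\<close>, and 1 plus the rescaled argument is \<open>m / n\<close>. The exponents
  of \<open>n\<close>, namely \<open>1 - 2 * a\<close>, \<open>2 * a + b\<close> and
  \<open>- 1\<close>, add up to \<open>b\<close>.\<close>

lemma betaprime_density_scale_cosh:
  fixes a b s t r :: real
  assumes "0 < s"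
  shows "betaprime_density (2 * a) b (s / (1 + cosh r / cosh t)) / (1 + cosh r / cosh t)
       = Gamma (2 * a + b) / (Gamma (2 * a) * Gamma b) * s powr (2 * a - 1) *
         (cosh t powr (2 * a) * ((cosh t + cosh r) powr b * ((1 + s) * cosh t + cosh r) powr (- (2 * a + b))))"
proof -
  define n m where "n = cosh t + cosh r" and "m = (1 + s) * cosh t + cosh r"
  have pos: "0 < n" "0 < m" "0 < cosh t" using assms by (auto simp: n_def m_def intro!: add_pos_pos mult_pos_pos)
  have R: "1 + cosh r / cosh t = n / cosh t" by (simp add: n_def field_simps)
  have M: "1 + s / (n / cosh t) = m / n" using pos by (simp add: field_simps) (simp add: n_def m_def algebra_simps)
  have "(s / (n / cosh t)) powr (2 * a - 1) / (m / n) powr (2 * a + b) / (n / cosh t)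
      = s powr (2 * a - 1) * (cosh t powr (2 * a) * (n powr b * m powr (- (2 * a + b))))"
  proof -
    obtain s' n' m' c' where exps: "s = exp s'" "n = exp n'" "m = exp m'" "cosh t = exp c'"
      by (rule that[of "ln s" "ln n" "ln m" "ln (cosh t)"]) (simp_all add: pos assms)
    have exp_powr: "exp x powr y = exp (y * x)" for x y :: real by (simp add: powr_def)
    show ?thesis unfolding exps
      by (simp only: exp_powr divide_inverse flip: exp_add exp_minus) (simp add: algebra_simps)
  qed
  moreover have "betaprime_density (2 * a) b (s / (n / cosh t)) / (n / cosh t)
      = Gamma (2 * a + b) / (Gamma (2 * a) * Gamma b) *
        ((s / (n / cosh t)) powr (2 * a - 1) / (m / n) powr (2 * a + b) / (n / cosh t))"
    unfolding betaprime_density_def M using assms pos by simp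
  ultimately show ?thesis
    unfolding R by (simp add: n_def m_def)
qed

text \<open>Both beta variables pass to the coordinates of \<open>nn_integral_sech_square\<close>.
  The power \<open>cosh t powr (- 2 * a)\<close> from the first of them cancels the one in
  \<open>betaprime_density_scale_cosh\<close>, which leaves the integrand of
  \<open>nn_integral_cosh_kernel_plane\<close> with \<open>n = 1 + s\<close>.\<close>

lemma nn_integral_betaprime_beta_beta:
  fixes a b s :: real
  assumes a: "0 < a" and b: "0 < b" "b < 1/2" and s: "0 < s"
  shows "(\<integral>\<^sup>+u. ennreal (beta_density a (1/2) u) * (\<integral>\<^sup>+v. ennreal (beta_density b (1/2 - b) v) *
           ennreal (betaprime_density (2 * a) b (s / (1 + sqrt (u / v))) / (1 + sqrt (u / v))) \<partial>lborel) \<partial>lborel)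
     = ennreal (2 * Gamma (a + 1/2) / (Gamma a * Gamma (1/2)) * (2 * Gamma (1/2) / (Gamma b * Gamma (1/2 - b))) *
          (Gamma (2 * a + b) / (Gamma (2 * a) * Gamma b)) * s powr (2 * a - 1)) *
       (\<integral>\<^sup>+t\<in>{0<..}. (\<integral>\<^sup>+r\<in>{0<..}. ennreal (sinh r powr (- 2 * b) *
            (cosh t + cosh r) powr b * ((1 + s) * cosh t + cosh r) powr (- (2 * a + b))) \<partial>lborel) \<partial>lborel)"
proof -
  define CU where "CU = 2 * Gamma (a + 1/2) / (Gamma a * Gamma (1/2))"
  define CV where "CV = 2 * Gamma (1/2) / (Gamma b * Gamma (1/2 - b))"
  define CY where "CY = Gamma (2 * a + b) / (Gamma (2 * a) * Gamma b)"
  define h where "h u v = ennreal (betaprime_density (2 * a) b (s / (1 + sqrt (u / v))) / (1 + sqrt (u / v)))" for u v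
  define kern where "kern t r = sinh r powr (- 2 * b) * ((cosh t + cosh r) powr b * ((1 + s) * cosh t + cosh r) powr (- (2 * a + b)))" for t r
  have [measurable]: "(\<lambda>(u, v). h u v) \<in> borel_measurable (borel \<Otimes>\<^sub>M borel)"
    "(\<lambda>(t, r). kern t r) \<in> borel_measurable (borel \<Otimes>\<^sub>M borel)"
    unfolding h_def kern_def by measurable
  have nonneg: "0 \<le> CU" "0 \<le> CV" "0 \<le> CY" using a b by (simp_all add: CU_def CV_def CY_def)
  have "(\<integral>\<^sup>+u. ennreal (beta_density a (1/2) u) * (\<integral>\<^sup>+v. ennreal (beta_density b (1/2 - b) v) * h u v \<partial>lborel) \<partial>lborel)
      = (\<integral>\<^sup>+u. ennreal (beta_density a (1/2) u) * (\<integral>\<^sup>+r\<in>{0<..}. ennreal (CV * sinh r powr (- 2 * b)) * h u (1 / (cosh r)\<^sup>2) \<partial>lborel) \<partial>lborel)"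
  proof -
    have "(\<integral>\<^sup>+v. ennreal (beta_density b (1/2 - b) v) * h u v \<partial>lborel)
        = (\<integral>\<^sup>+r\<in>{0<..}. ennreal (CV * sinh r powr (- 2 * b)) * h u (1 / (cosh r)\<^sup>2) \<partial>lborel)" for u
      using b by (subst nn_integral_beta_density_sech_square) (simp_all add: CV_def)
    thus ?thesis by simp
  qed
  also have "\<dots> = (\<integral>\<^sup>+t\<in>{0<..}. ennreal (CU * cosh t powr (- 2 * a)) * (\<integral>\<^sup>+r\<in>{0<..}.
      ennreal (CV * sinh r powr (- 2 * b)) * h (1 / (cosh t)\<^sup>2) (1 / (cosh r)\<^sup>2) \<partial>lborel) \<partial>lborel)"
    using a by (subst nn_integral_beta_density_sech_square)
      (auto simp: CU_def intro!: nn_integral_cong split: split_indicator)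
  also have "\<dots> = (\<integral>\<^sup>+t. ennreal (CU * CV * CY * s powr (2 * a - 1)) * ((\<integral>\<^sup>+r\<in>{0<..}. ennreal (kern t r) \<partial>lborel) * indicator {0<..} t) \<partial>lborel)"
  proof (rule nn_integral_cong)
    fix t :: real
    have "ennreal (CU * cosh t powr (- 2 * a)) * (\<integral>\<^sup>+r\<in>{0<..}.
        ennreal (CV * sinh r powr (- 2 * b)) * h (1 / (cosh t)\<^sup>2) (1 / (cosh r)\<^sup>2) \<partial>lborel)
      = (\<integral>\<^sup>+r. ennreal (CU * cosh t powr (- 2 * a)) * (
        ennreal (CV * sinh r powr (- 2 * b)) * h (1 / (cosh t)\<^sup>2) (1 / (cosh r)\<^sup>2) * indicator {0<..} r) \<partial>lborel)"
      by (rule nn_integral_cmult[symmetric]) measurable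
    also have "\<dots> = (\<integral>\<^sup>+r. ennreal (CU * CV * CY * s powr (2 * a - 1)) * (ennreal (kern t r) * indicator {0<..} r) \<partial>lborel)"
    proof (rule nn_integral_cong)
      fix r :: real
      have sq: "sqrt ((1 / (cosh t)\<^sup>2) / (1 / (cosh r)\<^sup>2)) = cosh r / cosh t"
        by (simp add: real_sqrt_divide)
      have "cosh t powr (- 2 * a) * cosh t powr (2 * a) = 1" by (simp flip: powr_add)
      hence eq: "CU * cosh t powr (- 2 * a) * (CV * sinh r powr (- 2 * b) * (CY * s powr (2 * a - 1) *
         (cosh t powr (2 * a) * ((cosh t + cosh r) powr b * ((1 + s) * cosh t + cosh r) powr (- (2 * a + b))))))
         = CU * CV * CY * s powr (2 * a - 1) * kern t r"
        by (simp add: kern_def mult_ac)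
      have merge: "ennreal A * (ennreal B * ennreal D * I) = ennreal (A * (B * D)) * I"
        if "0 \<le> A" "0 \<le> B" for A B D :: real and I :: ennreal
        using that by (simp add: ennreal_mult' mult.assoc)
      have "ennreal (CU * cosh t powr (- 2 * a)) * (
        ennreal (CV * sinh r powr (- 2 * b)) * h (1 / (cosh t)\<^sup>2) (1 / (cosh r)\<^sup>2) * indicator {0<..} r)
        = ennreal (CU * cosh t powr (- 2 * a) * (CV * sinh r powr (- 2 * b) * (CY * s powr (2 * a - 1) *
         (cosh t powr (2 * a) * ((cosh t + cosh r) powr b * ((1 + s) * cosh t + cosh r) powr (- (2 * a + b))))))) *
          indicator {0<..} r"
        unfolding h_def sq betaprime_density_scale_cosh[OF s] CY_def[symmetric]
        by (rule merge) (use nonneg in auto)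
      also have "\<dots> = ennreal (CU * CV * CY * s powr (2 * a - 1)) * (ennreal (kern t r) * indicator {0<..} r)"
        unfolding eq using nonneg by (simp add: ennreal_mult' mult.assoc)
      finally show "ennreal (CU * cosh t powr (- 2 * a)) * (
        ennreal (CV * sinh r powr (- 2 * b)) * h (1 / (cosh t)\<^sup>2) (1 / (cosh r)\<^sup>2) * indicator {0<..} r)
        = ennreal (CU * CV * CY * s powr (2 * a - 1)) * (ennreal (kern t r) * indicator {0<..} r)" .
    qed
    also have "\<dots> = ennreal (CU * CV * CY * s powr (2 * a - 1)) * (\<integral>\<^sup>+r\<in>{0<..}. ennreal (kern t r) \<partial>lborel)"
      by (rule nn_integral_cmult) measurable
    finally show "ennreal (CU * cosh t powr (- 2 * a)) * (\<integral>\<^sup>+r\<in>{0<..}.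
        ennreal (CV * sinh r powr (- 2 * b)) * h (1 / (cosh t)\<^sup>2) (1 / (cosh r)\<^sup>2) \<partial>lborel) * indicator {0<..} t
      = ennreal (CU * CV * CY * s powr (2 * a - 1)) * ((\<integral>\<^sup>+r\<in>{0<..}. ennreal (kern t r) \<partial>lborel) * indicator {0<..} t)"
      by (simp add: mult.assoc)
  qed
  also have "\<dots> = ennreal (CU * CV * CY * s powr (2 * a - 1)) * (\<integral>\<^sup>+t\<in>{0<..}. (\<integral>\<^sup>+r\<in>{0<..}. ennreal (kern t r) \<partial>lborel) \<partial>lborel)"
    by (rule nn_integral_cmult) measurable
  finally show ?thesis
    unfolding CU_def CV_def CY_def h_def kern_def by (simp only: mult.assoc)
qed

section \<open>Laws of functions of independent variables\<close>

text \<open>By independence the joint law is a product measure, integrated one coordinate at a time.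
  Coordinate 0 is innermost, so that the beta prime factor can be rescaled while the other two are
  held fixed.\<close>

lemma (in prob_space) nn_integral_indep_three:
  fixes X :: "nat \<Rightarrow> 'a \<Rightarrow> real" and f :: "nat \<Rightarrow> real \<Rightarrow> ennreal" and g :: "real \<times> real \<times> real \<Rightarrow> ennreal"
  assumes indep: "indep_vars (\<lambda>_. borel) X {0, 1, 2}"
    and X: "\<And>i. i \<in> {0, 1, 2} \<Longrightarrow> distributed M lborel (X i) (f i)"
    and g[measurable]: "g \<in> borel_measurable (borel \<Otimes>\<^sub>M borel \<Otimes>\<^sub>M borel)"
  shows "(\<integral>\<^sup>+\<omega>. g (X 0 \<omega>, X 1 \<omega>, X 2 \<omega>) \<partial>M)
       = (\<integral>\<^sup>+y. f 1 y * (\<integral>\<^sup>+z. f 2 z * (\<integral>\<^sup>+x. f 0 x * g (x, y, z) \<partial>lborel) \<partial>lborel) \<partial>lborel)"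
proof -
  \<comment> \<open>The locale \<open>product_prob_space\<close> asks for a probability space at
    every index, so indices outside the three receive the law of \<open>X 0\<close>.\<close>
  define D where "D i = distr M borel (X (if i \<in> {0, 1, 2} then i else 0))" for i
  have rv[measurable]: "X i \<in> borel_measurable M" if "i \<in> {0, 1, 2}" for i
    using distributed_measurable[OF X[OF that]] by simp
  have f[measurable]: "f i \<in> borel_measurable borel" if "i \<in> {0, 1, 2}" for i
    using distributed_borel_measurable[OF X[OF that]] by simp
  have D_density: "D i = density lborel (f i)" if "i \<in> {0, 1, 2}" for i
  proof -
    have "D i = distr M lborel (X i)"
      using that unfolding D_def by (intro distr_cong) auto
    thus ?thesis using distributed_distr_eq_density[OF X[OF that]] by simp
  qed
  have "prob_space (D i)" for i
    unfolding D_def by (rule prob_space_distr) (auto intro!: rv)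
  then interpret P: product_prob_space D
    unfolding product_prob_space_def product_prob_space_axioms_def product_sigma_finite_def
    by (auto intro: prob_space_imp_sigma_finite)
  have sets_D[measurable_cong]: "sets (D i) = sets borel" for i by (simp add: D_def)
  have sets_P: "sets (PiM I D) = sets (PiM I (\<lambda>_. borel))" for I
    by (intro sets_PiM_cong) (simp_all add: sets_D)
  have "distr M (PiM {0, 1, 2} (\<lambda>_. borel)) (\<lambda>\<omega>. \<lambda>i\<in>{0, 1, 2}. X i \<omega>)
      = PiM {0, 1, 2} (\<lambda>i. distr M borel (X i))"
    using indep by (subst (asm) indep_vars_iff_distr_eq_PiM') (auto intro!: rv)
  also have "\<dots> = PiM {0, 1, 2} D"
    by (intro PiM_cong) (auto simp: D_def)
  finally have joint: "distr M (PiM {0, 1, 2} (\<lambda>_. borel)) (\<lambda>\<omega>. \<lambda>i\<in>{0, 1, 2}. X i \<omega>) = PiM {0, 1, 2} D" .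
  have G[measurable]: "(\<lambda>x. g (x 0, x 1, x 2)) \<in> borel_measurable (PiM {0, 1, 2::nat} (\<lambda>_. borel))"
  proof -
    have "(\<lambda>x. (x 0, x 1, x 2)) \<in> PiM {0, 1, 2::nat} (\<lambda>_. borel) \<rightarrow>\<^sub>M borel \<Otimes>\<^sub>M borel \<Otimes>\<^sub>M borel"
      by (intro measurable_Pair measurable_component_singleton) auto
    from measurable_compose[OF this g] show ?thesis by simp
  qed
  have "(\<integral>\<^sup>+\<omega>. g (X 0 \<omega>, X 1 \<omega>, X 2 \<omega>) \<partial>M)
      = (\<integral>\<^sup>+x. g (x 0, x 1, x 2) \<partial>distr M (PiM {0, 1, 2::nat} (\<lambda>_. borel)) (\<lambda>\<omega>. \<lambda>i\<in>{0, 1, 2}. X i \<omega>))"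
  proof (subst nn_integral_distr)
    show "(\<lambda>\<omega>. \<lambda>i\<in>{0, 1, 2}. X i \<omega>) \<in> M \<rightarrow>\<^sub>M PiM {0, 1, 2} (\<lambda>_. borel)"
      by (intro measurable_restrict rv)
  qed (use G in \<open>simp_all del: One_nat_def\<close>)
  also have "\<dots> = (\<integral>\<^sup>+x. g (x 0, x 1, x 2) \<partial>PiM (insert 0 {1, 2}) D)"
    unfolding joint ..
  also have "\<dots> = (\<integral>\<^sup>+x. (\<integral>\<^sup>+t. g (t, x 1, x 2) \<partial>D 0) \<partial>PiM (insert 2 {1}) D)"
    by (subst P.product_nn_integral_insert)
      (use G in \<open>simp_all add: measurable_cong_sets[OF sets_P refl] insert_commute del: One_nat_def\<close>)
  also have "\<dots> = (\<integral>\<^sup>+x. (\<integral>\<^sup>+z. (\<integral>\<^sup>+t. g (t, x 1, z) \<partial>D 0) \<partial>D 2) \<partial>PiM {1} D)"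
  proof (subst P.product_nn_integral_insert)
    have "(\<lambda>x. (x 1, x 2)) \<in> PiM (insert 2 {1::nat}) (\<lambda>_. borel) \<rightarrow>\<^sub>M borel \<Otimes>\<^sub>M borel"
      by (intro measurable_Pair measurable_component_singleton) auto
    moreover have "(\<lambda>(y, z). \<integral>\<^sup>+t. g (t, y, z) \<partial>D 0) \<in> borel_measurable (borel \<Otimes>\<^sub>M borel)"
      by measurable
    ultimately have "(\<lambda>x. \<integral>\<^sup>+t. g (t, x 1, x 2) \<partial>D 0) \<in> borel_measurable (PiM (insert 2 {1}) (\<lambda>_. borel))"
      using measurable_compose by fastforce
    thus "(\<lambda>x. \<integral>\<^sup>+t. g (t, x 1, x 2) \<partial>D 0) \<in> borel_measurable (PiM (insert 2 {1}) D)"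
      by (simp only: measurable_cong_sets[OF sets_P refl])
  qed simp_all
  also have "\<dots> = (\<integral>\<^sup>+y. (\<integral>\<^sup>+z. (\<integral>\<^sup>+t. g (t, y, z) \<partial>D 0) \<partial>D 2) \<partial>D 1)"
    by (rule P.product_nn_integral_singleton) measurable
  also have "\<dots> = (\<integral>\<^sup>+y. f 1 y * (\<integral>\<^sup>+z. f 2 z * (\<integral>\<^sup>+x. f 0 x * g (x, y, z) \<partial>lborel) \<partial>lborel) \<partial>lborel)"
    by (simp add: D_density nn_integral_density)
  finally show ?thesis .
qed

lemma (in prob_space) distributed_sum_two:
  fixes X :: "nat \<Rightarrow> 'a \<Rightarrow> real"
  assumes indep: "indep_vars (\<lambda>_. borel) X {0, 1}"
    and X: "\<And>i. i \<in> {0, 1} \<Longrightarrow> distributed M lborel (X i) f"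
  shows "distr M borel (\<lambda>\<omega>. X 0 \<omega> + X 1 \<omega>) = density lborel (\<lambda>s. \<integral>\<^sup>+y. f (s - y) * f y \<partial>lborel)"
proof -
  \<comment> \<open>The rule separates one variable from the sum over the others; here that sum runs
    over \<open>{1}\<close> and is just \<open>X 1\<close>.\<close>
  have "indep_var borel (X 0) borel (X 1)"
    using indep_vars_sum[of "{1}" 0 X] indep by simp
  hence "distributed M lborel (\<lambda>\<omega>. X 0 \<omega> + X 1 \<omega>) (\<lambda>s. \<integral>\<^sup>+y. f (s - y) * f y \<partial>lborel)"
    using X by (intro distributed_convolution) auto
  from distributed_distr_eq_density[OF this] show ?thesis
    by (metis distr_cong sets_lborel)
qed

lemma nn_integral_betaprime_scale:
  fixes p q R :: real
  assumes R: "0 < R" and [measurable]: "E \<in> sets borel"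
  shows "(\<integral>\<^sup>+y. ennreal (betaprime_density p q y) * indicator E (y * R) \<partial>lborel)
       = (\<integral>\<^sup>+s. ennreal (betaprime_density p q (s / R) / R) * indicator E s \<partial>lborel)"
proof -
  have "(\<integral>\<^sup>+y. ennreal (betaprime_density p q y) * indicator E (y * R) \<partial>lborel)
      = ennreal \<bar>1 / R\<bar> * (\<integral>\<^sup>+s. ennreal (betaprime_density p q (0 + 1 / R * s)) * indicator E ((0 + 1 / R * s) * R) \<partial>lborel)"
    using R by (intro nn_integral_real_affine) auto
  also have "\<dots> = (\<integral>\<^sup>+s. ennreal (1 / R) * (ennreal (betaprime_density p q (s / R)) * indicator E s) \<partial>lborel)"
    using R by (subst nn_integral_cmult) auto
  also have "\<dots> = (\<integral>\<^sup>+s. ennreal (betaprime_density p q (s / R) / R) * indicator E s \<partial>lborel)"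
    using R by (intro nn_integral_cong) (simp add: divide_inverse ennreal_mult' mult_ac)
  finally show ?thesis .
qed

text \<open>For fixed positive \<open>u\<close> and \<open>v\<close> the product is \<open>Y\<close>
  times a positive constant, and \<open>nn_integral_betaprime_scale\<close> gives its density.
  Averaging over \<open>u\<close> and \<open>v\<close> and moving \<open>s\<close> to the outside
  gives the density of the product.\<close>

lemma (in prob_space) distr_betaprime_times_sqrt_ratio:
  fixes Y U V :: "'a \<Rightarrow> real" and a b :: real
  assumes indep: "indep_vars (\<lambda>_. borel) (\<lambda>i. [Y, U, V] ! i) {0, 1, 2}"
    and Y: "distributed M lborel Y (\<lambda>x. ennreal (betaprime_density (2 * a) b x))"
    and U: "distributed M lborel U (\<lambda>x. ennreal (beta_density a (1/2) x))"
    and V: "distributed M lborel V (\<lambda>x. ennreal (beta_density b (1/2 - b) x))"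
  shows "distr M borel (\<lambda>\<omega>. Y \<omega> * (1 + sqrt (U \<omega> / V \<omega>)))
       = density lborel (\<lambda>s. \<integral>\<^sup>+u. ennreal (beta_density a (1/2) u) * (\<integral>\<^sup>+v. ennreal (beta_density b (1/2 - b) v) *
           ennreal (betaprime_density (2 * a) b (s / (1 + sqrt (u / v))) / (1 + sqrt (u / v))) \<partial>lborel) \<partial>lborel)"
    (is "?L = density lborel ?h")
proof (rule measure_eqI)
  define k where "k s u v = ennreal (betaprime_density (2 * a) b (s / (1 + sqrt (u / v))) / (1 + sqrt (u / v)))" for s u v
  have rv[measurable]: "Y \<in> borel_measurable M" "U \<in> borel_measurable M" "V \<in> borel_measurable M"
    using Y U V by (auto dest: distributed_measurable)
  fix E assume "E \<in> sets ?L"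
  hence E[measurable]: "E \<in> sets borel" by simp
  define g where "g = (\<lambda>(y, u, v). indicator E (y * (1 + sqrt (u / v))) :: ennreal)"
  have [measurable]: "g \<in> borel_measurable (borel \<Otimes>\<^sub>M borel \<Otimes>\<^sub>M borel)"
    unfolding g_def by measurable
  have "emeasure ?L E = (\<integral>\<^sup>+\<omega>. g (Y \<omega>, U \<omega>, V \<omega>) \<partial>M)"
  proof -
    have "emeasure ?L E = (\<integral>\<^sup>+x. indicator E x \<partial>?L)" by simp
    also have "\<dots> = (\<integral>\<^sup>+\<omega>. g (Y \<omega>, U \<omega>, V \<omega>) \<partial>M)"
      by (subst nn_integral_distr) (auto simp: g_def)
    finally show ?thesis .
  qed
  also have "\<dots> = (\<integral>\<^sup>+u. ennreal (beta_density a (1/2) u) * (\<integral>\<^sup>+v. ennreal (beta_density b (1/2 - b) v) *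
      (\<integral>\<^sup>+y. ennreal (betaprime_density (2 * a) b y) * g (y, u, v) \<partial>lborel) \<partial>lborel) \<partial>lborel)"
  proof -
    have "distributed M lborel ([Y, U, V] ! i) ([\<lambda>x. ennreal (betaprime_density (2 * a) b x),
        \<lambda>x. ennreal (beta_density a (1/2) x), \<lambda>x. ennreal (beta_density b (1/2 - b) x)] ! i)"
      if "i \<in> {0, 1, 2}" for i
      using that Y U V by (auto simp: numeral_2_eq_2)
    from nn_integral_indep_three[OF indep this, of g] show ?thesis
      by (simp add: numeral_2_eq_2)
  qed
  also have "\<dots> = (\<integral>\<^sup>+u. (\<integral>\<^sup>+v. (\<integral>\<^sup>+s. ennreal (beta_density a (1/2) u) * (ennreal (beta_density b (1/2 - b) v) *
      (k s u v * indicator E s)) \<partial>lborel) \<partial>lborel) \<partial>lborel)"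
  proof (rule nn_integral_cong)
    fix u :: real
    have "ennreal (beta_density a (1/2) u) * (ennreal (beta_density b (1/2 - b) v) *
        (\<integral>\<^sup>+y. ennreal (betaprime_density (2 * a) b y) * g (y, u, v) \<partial>lborel))
      = (\<integral>\<^sup>+s. ennreal (beta_density a (1/2) u) * (ennreal (beta_density b (1/2 - b) v) *
          (k s u v * indicator E s)) \<partial>lborel)" for v
    \<comment> \<open>Off the open quadrant the scale may fail to be positive, as
      \<open>sqrt\<close> is odd on the reals, but there one of the beta densities vanishes.\<close>
    proof (cases "0 < u \<and> 0 < v")
      case True
      have R: "0 < 1 + sqrt (u / v)" using True by (simp add: add_pos_nonneg)
      have [measurable]: "(\<lambda>s. k s u v) \<in> borel_measurable borel" unfolding k_def by measurable
      have "(\<integral>\<^sup>+y. ennreal (betaprime_density (2 * a) b y) * g (y, u, v) \<partial>lborel) = (\<integral>\<^sup>+s. k s u v * indicator E s \<partial>lborel)"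
        unfolding k_def g_def using nn_integral_betaprime_scale[OF R E] by simp
      thus ?thesis by (subst nn_integral_cmult, measurable, subst nn_integral_cmult, measurable)
    next
      case False
      hence "beta_density a (1/2) u = 0 \<or> beta_density b (1/2 - b) v = 0"
        by (auto simp: beta_density_def)
      thus ?thesis by auto
    qed
    moreover have "ennreal (beta_density a (1/2) u) * (\<integral>\<^sup>+v. ennreal (beta_density b (1/2 - b) v) *
        (\<integral>\<^sup>+y. ennreal (betaprime_density (2 * a) b y) * g (y, u, v) \<partial>lborel) \<partial>lborel)
      = (\<integral>\<^sup>+v. ennreal (beta_density a (1/2) u) * (ennreal (beta_density b (1/2 - b) v) *
        (\<integral>\<^sup>+y. ennreal (betaprime_density (2 * a) b y) * g (y, u, v) \<partial>lborel)) \<partial>lborel)"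
      by (rule nn_integral_cmult[symmetric]) measurable
    ultimately show "ennreal (beta_density a (1/2) u) * (\<integral>\<^sup>+v. ennreal (beta_density b (1/2 - b) v) *
        (\<integral>\<^sup>+y. ennreal (betaprime_density (2 * a) b y) * g (y, u, v) \<partial>lborel) \<partial>lborel)
      = (\<integral>\<^sup>+v. (\<integral>\<^sup>+s. ennreal (beta_density a (1/2) u) * (ennreal (beta_density b (1/2 - b) v) *
          (k s u v * indicator E s)) \<partial>lborel) \<partial>lborel)"
      by simp
  qed
  \<comment> \<open>Two applications of Tonelli move \<open>s\<close> outward, first past
    \<open>v\<close> and then past \<open>u\<close>.\<close>
  also have "\<dots> = (\<integral>\<^sup>+u. (\<integral>\<^sup>+s. (\<integral>\<^sup>+v. ennreal (beta_density a (1/2) u) * (ennreal (beta_density b (1/2 - b) v) *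
      (k s u v * indicator E s)) \<partial>lborel) \<partial>lborel) \<partial>lborel)"
    by (intro nn_integral_cong lborel_pair.Fubini') (unfold k_def, measurable)
  also have "\<dots> = (\<integral>\<^sup>+s. (\<integral>\<^sup>+u. (\<integral>\<^sup>+v. ennreal (beta_density a (1/2) u) * (ennreal (beta_density b (1/2 - b) v) *
      (k s u v * indicator E s)) \<partial>lborel) \<partial>lborel) \<partial>lborel)"
    by (rule lborel_pair.Fubini') (unfold k_def, measurable)
  also have "\<dots> = (\<integral>\<^sup>+s. ?h s * indicator E s \<partial>lborel)"
  proof (rule nn_integral_cong)
    fix s :: real
    have [measurable]: "(\<lambda>(u, v). k s u v) \<in> borel_measurable (borel \<Otimes>\<^sub>M borel)"
      unfolding k_def by measurable
    have "(\<integral>\<^sup>+u. (\<integral>\<^sup>+v. ennreal (beta_density a (1/2) u) * (ennreal (beta_density b (1/2 - b) v) *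
        (k s u v * indicator E s)) \<partial>lborel) \<partial>lborel)
      = (\<integral>\<^sup>+u. (\<integral>\<^sup>+v. indicator E s * (ennreal (beta_density a (1/2) u) * (ennreal (beta_density b (1/2 - b) v) *
        k s u v)) \<partial>lborel) \<partial>lborel)"
      by (simp add: mult_ac)
    also have "\<dots> = (\<integral>\<^sup>+u. indicator E s * (ennreal (beta_density a (1/2) u) * (\<integral>\<^sup>+v. ennreal (beta_density b (1/2 - b) v) *
        k s u v \<partial>lborel)) \<partial>lborel)"
      by (intro nn_integral_cong) (subst nn_integral_cmult, measurable, subst nn_integral_cmult, measurable)
    also have "\<dots> = indicator E s * (\<integral>\<^sup>+u. ennreal (beta_density a (1/2) u) * (\<integral>\<^sup>+v. ennreal (beta_density b (1/2 - b) v) *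
        k s u v \<partial>lborel) \<partial>lborel)"
      by (rule nn_integral_cmult) measurable
    finally show "(\<integral>\<^sup>+u. (\<integral>\<^sup>+v. ennreal (beta_density a (1/2) u) * (ennreal (beta_density b (1/2 - b) v) *
        (k s u v * indicator E s)) \<partial>lborel) \<partial>lborel) = ?h s * indicator E s"
      by (simp add: k_def mult.commute)
  qed
  also have "\<dots> = emeasure (density lborel ?h) E"
    by (rule emeasure_density[symmetric]) measurable
  finally show "emeasure ?L E = emeasure (density lborel ?h) E" .
qed simp

section \<open>Proportional probability densities and the conclusion\<close>

text \<open>Integrating the proportionality and using total mass one forces
  \<open>\<alpha> = \<beta>\<close>, and a finite positive constant cancels. Normalising constants
  thus never have to be compared through Gamma identities.\<close>

lemma ennreal_proportional_densities_eq:
  fixes f g :: "'a \<Rightarrow> ennreal" and \<alpha> \<beta> :: real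
  assumes pos: "0 < \<alpha>" "0 < \<beta>" and proportional: "\<And>x. ennreal \<alpha> * f x = ennreal \<beta> * g x"
    and [measurable]: "f \<in> borel_measurable M" "g \<in> borel_measurable M"
    and f: "prob_space (density M f)" and g: "prob_space (density M g)"
  shows "density M f = density M g"
proof -
  have total: "(\<integral>\<^sup>+x. h x \<partial>M) = 1" if "prob_space (density M h)" "h \<in> borel_measurable M" for h
    using prob_space.emeasure_space_1[OF that(1)] that(2)
    by (simp add: emeasure_density cong: nn_integral_cong)
  have "ennreal \<alpha> = (\<integral>\<^sup>+x. ennreal \<alpha> * f x \<partial>M)"
    by (simp add: nn_integral_cmult total[OF f])
  also have "\<dots> = ennreal \<beta>"
    by (simp add: proportional nn_integral_cmult total[OF g])
  finally have "f x = g x" for x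
    using proportional[of x] pos by (simp add: ennreal_mult_cancel_left)
  thus ?thesis by (intro density_cong) auto
qed

theorem theoremB:
  fixes M :: "'a measure" and N :: "'b measure"
    and a b :: real
    and X :: "nat \<Rightarrow> 'a \<Rightarrow> real"
    and Y U V :: "'b \<Rightarrow> real"
  assumes b_pos: "0 < b" and b_lt: "b < 1/2"
    and a_cases: "a = 1 - b \<or> a = 1/2"
    and M_prob: "prob_space M"
    and X_indep: "prob_space.indep_vars M (\<lambda>_. borel) X {0, 1}"
    and X_distr: "\<And>i. i \<in> {0, 1} \<Longrightarrow>
        distributed M lborel (X i) (\<lambda>x. ennreal (betaprime_density a b x))"
    and N_prob: "prob_space N"
    and YUV_indep: "prob_space.indep_vars N (\<lambda>_. borel) (\<lambda>i. [Y, U, V] ! i) {0, 1, 2}"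
    and Y_distr: "distributed N lborel Y (\<lambda>x. ennreal (betaprime_density (2 * a) b x))"
    and U_distr: "distributed N lborel U (\<lambda>x. ennreal (beta_density a (1/2) x))"
    and V_distr: "distributed N lborel V (\<lambda>x. ennreal (beta_density b (1/2 - b) x))"
  shows "distr M borel (\<lambda>\<omega>. X 0 \<omega> + X 1 \<omega>)
       = distr N borel (\<lambda>\<omega>. Y \<omega> * (1 + sqrt (U \<omega> / V \<omega>)))"
proof -
  interpret M: prob_space M by (rule M_prob)
  interpret N: prob_space N by (rule N_prob)
  have a: "0 < a" using a_cases b_lt by auto
  define f where "f s = (\<integral>\<^sup>+y. ennreal (betaprime_density a b (s - y)) * ennreal (betaprime_density a b y) \<partial>lborel)" for s
  define h where "h s = (\<integral>\<^sup>+u. ennreal (beta_density a (1/2) u) * (\<integral>\<^sup>+v. ennreal (beta_density b (1/2 - b) v) *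
      ennreal (betaprime_density (2 * a) b (s / (1 + sqrt (u / v))) / (1 + sqrt (u / v))) \<partial>lborel) \<partial>lborel)" for s
  have f_distr: "distr M borel (\<lambda>\<omega>. X 0 \<omega> + X 1 \<omega>) = density lborel f"
    unfolding f_def[abs_def] by (rule M.distributed_sum_two[OF X_indep X_distr])
  have h_distr: "distr N borel (\<lambda>\<omega>. Y \<omega> * (1 + sqrt (U \<omega> / V \<omega>))) = density lborel h"
    unfolding h_def[abs_def] by (rule N.distr_betaprime_times_sqrt_ratio[OF YUV_indep Y_distr U_distr V_distr])
  have [measurable]: "f \<in> borel_measurable borel" "h \<in> borel_measurable borel"
    unfolding f_def[abs_def] h_def[abs_def] by measurable
  \<comment> \<open>\<open>K\<close> and \<open>C\<close> are the constants in the density of the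
    sum, \<open>D\<close> is the one in the density of the product, and \<open>A\<close> and
    \<open>B\<close> are those of the kernel identity.\<close>
  define B where "B = Beta (1/2 - b) b / 4"
  define A where "A = Beta b (2 * a + b)"
  define K where "K = Beta (a + b) (a + b)"
  define C where "C = 2 * (Gamma (a + b) / (Gamma a * Gamma b))\<^sup>2 * 2 powr (- 2 * a)"
  define D where "D = 2 * Gamma (a + 1/2) / (Gamma a * Gamma (1/2)) * (2 * Gamma (1/2) / (Gamma b * Gamma (1/2 - b))) *
          (Gamma (2 * a + b) / (Gamma (2 * a) * Gamma b))"
  have pos: "0 < A" "0 < B" "0 < C" "0 < D" "0 < K"
    using a b_pos b_lt unfolding A_def B_def C_def D_def K_def Beta_def
    by (auto simp: Gamma_one_half_real intro!: mult_pos_pos divide_pos_pos zero_less_power Gamma_real_pos)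
  have proportional: "ennreal (K * D * B) * f s = ennreal (C * A) * h s" for s
  proof (cases "0 < s")
    case True
    define H where "H = (\<integral>\<^sup>+t\<in>{0<..}. (\<integral>\<^sup>+r\<in>{0<..}. ennreal (sinh r powr (- 2 * b) *
            (cosh t + cosh r) powr b * ((1 + s) * cosh t + cosh r) powr (- (2 * a + b))) \<partial>lborel) \<partial>lborel)"
    define L where "L = (\<integral>\<^sup>+t. (\<integral>\<^sup>+x. ennreal (cosh ((t - x) / 2) powr (2 * b) *
            ((1 + s) * cosh t + cosh x) powr (- (b + (2 * a + b)))) \<partial>lborel) \<partial>lborel)"
    define S where "S = ennreal (s powr (2 * a - 1))"
    \<comment> \<open>The next three relations express \<open>f s\<close> through the plane integral
      \<open>L\<close> and \<open>h s\<close> through the quadrant integral \<open>H\<close>, and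
      link \<open>H\<close> to \<open>L\<close>; eliminating both integrals leaves the
      proportionality.\<close>
    have 1: "ennreal K * f s = ennreal C * S * L"
      using nn_integral_betaprime_convolution[OF a b_pos True] pos
      by (simp only: f_def K_def C_def L_def S_def ennreal_mult'[symmetric] less_imp_le)
    have 2: "h s = ennreal D * S * H"
      using nn_integral_betaprime_beta_beta[OF a b_pos b_lt True] pos
      by (simp only: h_def D_def H_def S_def ennreal_mult'[symmetric] less_imp_le)
    have 3: "ennreal A * H = ennreal B * L"
      unfolding A_def B_def H_def L_def
      by (rule nn_integral_cosh_kernel_plane) (use a b_pos b_lt True in auto)
    have "ennreal (K * D * B) * f s = ennreal D * ennreal B * (ennreal K * f s)"
      using pos by (simp add: ennreal_mult' mult_ac)
    also have "\<dots> = ennreal C * ennreal D * S * (ennreal B * L)"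
      unfolding 1 by (simp add: mult_ac)
    also have "\<dots> = ennreal (C * A) * h s"
      unfolding 2 3[symmetric] using pos by (simp add: ennreal_mult' mult_ac)
    finally show ?thesis .
  next
    case False
    have "f s = 0"
    proof -
      \<comment> \<open>The numbers \<open>s - y\<close> and \<open>y\<close> add up to
        \<open>s\<close>, so they cannot both be positive.\<close>
      have "ennreal (betaprime_density a b (s - y)) * ennreal (betaprime_density a b y) = 0" for y
        using False by (auto simp: betaprime_density_def)
      thus ?thesis by (simp only: f_def) simp
    qed
    moreover have "h s = 0"
    proof -
      have "ennreal (beta_density a (1/2) u) * (ennreal (beta_density b (1/2 - b) v) *
          ennreal (betaprime_density (2 * a) b (s / (1 + sqrt (u / v))) / (1 + sqrt (u / v)))) = 0" for u v
      \<comment> \<open>With \<open>u\<close> and \<open>v\<close> positive the scale is positive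
        and the beta prime density is taken at a nonpositive point; otherwise a beta density is
        zero.\<close>
      proof (cases "0 < u \<and> 0 < v")
        case True
        hence "0 < 1 + sqrt (u / v)" by (simp add: add_pos_nonneg)
        hence "s / (1 + sqrt (u / v)) \<le> 0" using False by (simp add: divide_le_0_iff)
        hence "betaprime_density (2 * a) b (s / (1 + sqrt (u / v))) = 0" by (simp add: betaprime_density_def)
        thus ?thesis by simp
      qed (auto simp: beta_density_def)
      hence "(\<integral>\<^sup>+v. ennreal (beta_density a (1/2) u) * (ennreal (beta_density b (1/2 - b) v) *
          ennreal (betaprime_density (2 * a) b (s / (1 + sqrt (u / v))) / (1 + sqrt (u / v)))) \<partial>lborel) = 0" for u
        by (simp only:) simp
      hence "ennreal (beta_density a (1/2) u) * (\<integral>\<^sup>+v. ennreal (beta_density b (1/2 - b) v) *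
          ennreal (betaprime_density (2 * a) b (s / (1 + sqrt (u / v))) / (1 + sqrt (u / v))) \<partial>lborel) = 0" for u
        by (subst (asm) nn_integral_cmult) auto
      thus ?thesis by (simp only: h_def) simp
    qed
    ultimately show ?thesis by simp
  qed
  \<comment> \<open>Total mass one is inherited from the laws of the random variables; no integral
    of \<open>f\<close> or \<open>h\<close> is evaluated.\<close>
  have "prob_space (density lborel f)"
  proof -
    have "(\<lambda>\<omega>. X 0 \<omega> + X 1 \<omega>) \<in> borel_measurable M"
      using X_distr[of 0] X_distr[of 1] by (auto dest!: distributed_measurable intro!: borel_measurable_add)
    thus ?thesis unfolding f_distr[symmetric] by (rule M.prob_space_distr)
  qed
  moreover have "prob_space (density lborel h)"
  proof -
    have [measurable]: "Y \<in> borel_measurable N" "U \<in> borel_measurable N" "V \<in> borel_measurable N"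
      using Y_distr U_distr V_distr by (auto dest: distributed_measurable)
    show ?thesis unfolding h_distr[symmetric] by (rule N.prob_space_distr) measurable
  qed
  ultimately have "density lborel f = density lborel h"
    by (intro ennreal_proportional_densities_eq[of "K * D * B" "C * A"]) (use pos proportional in auto)
  thus ?thesis unfolding f_distr h_distr .
qed

end
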